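(* Let $M$ be the complement of the figure-eight knot in $S^3$, with meridian $\alpha$ and longitude $\lambda$. For each $\gamma=p\alpha+q\lambda\in H_1(\partial M;\mathbb{Z})$, the Culler–Shalen norm of $\gamma$ is $$|\gamma|=|(p,q)|=2\bigl(|p+4q|+|p-4q|\bigr).$$
   Context: $\pi_1(M)=\langle\alpha,\beta\mid\beta^{-1}\alpha^{-1}\beta\alpha\beta^{-1}\alpha\beta\alpha^{-1}\beta^{-1}\alpha\rangle$ and the peripheral subgroup $\pi_1(\partial M)\cong H_1(\partial M;\mathbb{Z})$ is generated by the meridian $\alpha$ and the longitude $\lambda=\beta^{-1}\alpha\beta\alpha^{-1}\alpha^{-1}\beta\alpha\beta^{-1}$. $X_0$ is the irreducible component of the $SL_2(\mathbb{C})$-character variety of $M$ containing the characters of the discrete faithful representations; in coordinates $x=\chi(\alpha)=\chi(\beta)$, $z=\chi(\alpha\beta)$ it is the curve $z^2-(1+x^2)z+2x^2-1=0$ in $\mathbb{C}^2$. $\widetilde{X_0}$ is its smooth projective model. For $\gamma\in H_1(\partial M;\mathbb{Z})=\pi_1(\partial M)$, $I_\gamma(\chi)=\chi(\gamma)$ and $f_\gamma=I_\gamma^2-4$, regarded as a meromorphic function on $\widetilde{X_0}$. The Culler–Shalen norm is the norm $|\cdot|$ on $H_1(\partial M;\mathbb{R})$ satisfying $|\gamma|=\deg f_\gamma$ (degree as a map $\widetilde{X_0}\to\mathbb{CP}^1$) for $\gamma\in H_1(\partial M;\mathbb{Z})$. *)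

theory Defs
  imports "HOL-Analysis.Analysis" "HOL-Algebra.Group"
begin

section \<open>The fundamental group of the figure-eight knot complement\<close>

datatype generator = Alpha | Beta

text \<open>The letter \<open>(g, True)\<close> stands for \<open>g\<close> and \<open>(g, False)\<close> for its inverse.\<close>

type_synonym word = "(generator \<times> bool) list"

definition relator :: word where
  "relator =
    [(Beta, False), (Alpha, False), (Beta, True), (Alpha, True), (Beta, False),
     (Alpha, True), (Beta, True), (Alpha, False), (Beta, False), (Alpha, True)]"

inductive weq :: "word \<Rightarrow> word \<Rightarrow> bool" where
  refl: "weq u u"
| sym: "weq u v \<Longrightarrow> weq v u"
| trans: "weq u v \<Longrightarrow> weq v w \<Longrightarrow> weq u w"
| append: "weq u u' \<Longrightarrow> weq v v' \<Longrightarrow> weq (u @ v) (u' @ v')"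
| cancel: "weq [(g, s), (g, \<not> s)] []"
| relator: "weq relator []"

definition word_class :: "word \<Rightarrow> word set" where
  "word_class u = {w. weq u w}"

text \<open>The group \<open>\<langle>\<alpha>, \<beta> | relator\<rangle>\<close>, with classes of words as elements.\<close>

definition fig8_group :: "word set monoid" where
  "fig8_group =
     \<lparr>carrier = range word_class,
      mult = (\<lambda>U V. {w. \<exists>u\<in>U. \<exists>v\<in>V. weq (u @ v) w}),
      one = word_class []\<rparr>"

definition meridian :: "word set" where
  "meridian = word_class [(Alpha, True)]"

definition longitude :: "word set" where
  "longitude = word_class
    [(Beta, False), (Alpha, True), (Beta, True), (Alpha, False),
     (Alpha, False), (Beta, True), (Alpha, True), (Beta, False)]"

text \<open>The class \<open>p \<alpha> + q \<lambda>\<close> of \<open>H\<^sub>1(\<partial>M; \<int>) = \<pi>\<^sub>1(\<partial>M)\<close>, written multiplicatively.\<close>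

definition peripheral :: "int \<Rightarrow> int \<Rightarrow> word set" where
  "peripheral p q =
     (meridian [^]\<^bsub>fig8_group\<^esub> p) \<otimes>\<^bsub>fig8_group\<^esub> (longitude [^]\<^bsub>fig8_group\<^esub> q)"


section \<open>Characters\<close>

definition SL2C :: "(complex^2^2) monoid" where
  "SL2C = \<lparr>carrier = {A. det A = 1}, mult = (**), one = mat 1\<rparr>"

type_synonym character = "word set \<Rightarrow> complex"

definition character_of :: "(word set \<Rightarrow> complex^2^2) \<Rightarrow> character" where
  "character_of \<rho> = restrict (\<lambda>g. trace (\<rho> g)) (carrier fig8_group)"

definition character_variety :: "character set" where
  "character_variety = character_of ` hom fig8_group SL2C"

definition discrete_faithful :: "(word set \<Rightarrow> complex^2^2) \<Rightarrow> bool" where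
  "discrete_faithful \<rho> \<longleftrightarrow>
     \<rho> \<in> hom fig8_group SL2C \<and> inj_on \<rho> (carrier fig8_group) \<and>
     discrete (\<rho> ` carrier fig8_group)"

text \<open>
  The algebra generated by the trace functions \<open>I\<^sub>\<gamma>(\<chi>) = \<chi>(\<gamma>)\<close>. Its elements are the
  polynomial functions on the character variety: by the trace identities the functions
  \<open>x = I\<^sub>\<alpha> = I\<^sub>\<beta>\<close> and \<open>z = I\<^sub>\<alpha>\<^sub>\<beta>\<close> generate it there, so that the closed sets below are those
  of the embedding \<open>(x, z)\<close> into \<open>\<complex>\<^sup>2\<close>.
\<close>

inductive_set trace_algebra :: "(character \<Rightarrow> complex) set" where
  const: "(\<lambda>_. c) \<in> trace_algebra"
| trace_function: "\<gamma> \<in> carrier fig8_group \<Longrightarrow> (\<lambda>\<phi>. \<phi> \<gamma>) \<in> trace_algebra"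
| add: "f \<in> trace_algebra \<Longrightarrow> g \<in> trace_algebra \<Longrightarrow> (\<lambda>\<phi>. f \<phi> + g \<phi>) \<in> trace_algebra"
| mult: "f \<in> trace_algebra \<Longrightarrow> g \<in> trace_algebra \<Longrightarrow> (\<lambda>\<phi>. f \<phi> * g \<phi>) \<in> trace_algebra"

definition zariski_closed :: "character set \<Rightarrow> bool" where
  "zariski_closed Z \<longleftrightarrow>
     (\<exists>S \<subseteq> trace_algebra. Z = {\<phi> \<in> character_variety. \<forall>f\<in>S. f \<phi> = 0})"

definition zariski_irreducible :: "character set \<Rightarrow> bool" where
  "zariski_irreducible Z \<longleftrightarrow>
     Z \<noteq> {} \<and>
     (\<forall>Z1 Z2. zariski_closed Z1 \<and> zariski_closed Z2 \<and> Z = Z1 \<union> Z2 \<longrightarrow> Z = Z1 \<or> Z = Z2)"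

definition irreducible_component :: "character set \<Rightarrow> bool" where
  "irreducible_component X \<longleftrightarrow>
     zariski_closed X \<and> zariski_irreducible X \<and>
     (\<forall>Y. zariski_closed Y \<and> zariski_irreducible Y \<and> X \<subseteq> Y \<longrightarrow> Y = X)"

text \<open>
  The component \<open>X\<^sub>0\<close> of the discrete faithful characters; in the coordinates \<open>x, z\<close> it is the curve
  \<open>z\<^sup>2 - (1 + x\<^sup>2) z + 2 x\<^sup>2 - 1 = 0\<close>.
\<close>

definition canonical_component :: "character set \<Rightarrow> bool" where
  "canonical_component X \<longleftrightarrow>
     irreducible_component X \<and> (\<exists>\<rho>. discrete_faithful \<rho> \<and> character_of \<rho> \<in> X)"


section \<open>The smooth projective model and degrees\<close>

text \<open>
  Regular functions on \<open>X\<close> are extended by 0 outside \<open>X\<close>, so that they form a ring under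
  the pointwise operations of the full function type, with zero element \<open>\<lambda>_. 0\<close>.
\<close>

definition zero_ext :: "character set \<Rightarrow> (character \<Rightarrow> complex) \<Rightarrow> character \<Rightarrow> complex" where
  "zero_ext X f = (\<lambda>\<phi>. if \<phi> \<in> X then f \<phi> else 0)"

definition coordinate_ring :: "character set \<Rightarrow> (character \<Rightarrow> complex) set" where
  "coordinate_ring X = zero_ext X ` trace_algebra"

definition nonzero_regular :: "character set \<Rightarrow> (character \<Rightarrow> complex) set" where
  "nonzero_regular X = coordinate_ring X - {\<lambda>_. 0}"

text \<open>
  The points of the smooth projective model of an irreducible curve \<open>X\<close> are the discrete
  valuation rings of its function field over \<open>\<complex>\<close>, equivalently the normalized discrete
  valuations of that field which are trivial on \<open>\<complex>\<close>. As the function field is the field of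
  fractions of the coordinate ring, such a valuation is the same thing as its restriction
  \<open>v\<close> to the nonzero regular functions, with \<open>v (f/g) = v f - v g\<close>. The last clause fixes
  the value of \<open>v\<close> outside its domain, so that each point is represented once.
\<close>

definition smooth_model :: "character set \<Rightarrow> ((character \<Rightarrow> complex) \<Rightarrow> int) set" where
  "smooth_model X =
     {v. (\<forall>f\<in>nonzero_regular X. \<forall>g\<in>nonzero_regular X.
            v (\<lambda>\<phi>. f \<phi> * g \<phi>) = v f + v g) \<and>
         (\<forall>f\<in>nonzero_regular X. \<forall>g\<in>nonzero_regular X.
            (\<lambda>\<phi>. f \<phi> + g \<phi>) \<in> nonzero_regular X \<longrightarrow> min (v f) (v g) \<le> v (\<lambda>\<phi>. f \<phi> + g \<phi>)) \<and>
         (\<forall>c. c \<noteq> 0 \<longrightarrow> v (zero_ext X (\<lambda>_. c)) = 0) \<and>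
         (\<exists>f\<in>nonzero_regular X. \<exists>g\<in>nonzero_regular X. v f - v g = 1) \<and>
         (\<forall>f. f \<notin> nonzero_regular X \<longrightarrow> v f = 0)}"

text \<open>
  The number of preimages, counted with multiplicity, of a point of \<open>\<complex>\<P>\<^sup>1\<close> under the map
  from the smooth model to \<open>\<complex>\<P>\<^sup>1\<close> given by a nonconstant regular function \<open>f\<close>. \<open>None\<close> is the
  point at infinity, attained where \<open>f\<close> has a pole; \<open>Some c\<close> is attained where \<open>f - c\<close>
  vanishes.
\<close>

fun preimages :: "character set \<Rightarrow> (character \<Rightarrow> complex) \<Rightarrow> complex option \<Rightarrow> int" where
  "preimages X f None = (\<Sum>v | v \<in> smooth_model X \<and> v f < 0. - v f)"
| "preimages X f (Some c) =
     (\<Sum>v | v \<in> smooth_model X \<and> v (zero_ext X (\<lambda>\<phi>. f \<phi> - c)) > 0.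
        v (zero_ext X (\<lambda>\<phi>. f \<phi> - c)))"

text \<open>All points of \<open>\<complex>\<P>\<^sup>1\<close> have the same number of preimages; a constant map has degree 0.\<close>

definition map_degree :: "character set \<Rightarrow> (character \<Rightarrow> complex) \<Rightarrow> int" where
  "map_degree X f =
     (if \<exists>c. f = zero_ext X (\<lambda>_. c) then 0 else THE d. \<forall>y. preimages X f y = d)"


section \<open>The Culler--Shalen norm\<close>

definition f_gamma :: "character set \<Rightarrow> word set \<Rightarrow> character \<Rightarrow> complex" where
  "f_gamma X \<gamma> = zero_ext X (\<lambda>\<phi>. (\<phi> \<gamma>)\<^sup>2 - 4)"

definition is_norm :: "('v::real_vector \<Rightarrow> real) \<Rightarrow> bool" where
  "is_norm N \<longleftrightarrow>
     (\<forall>u. N u = 0 \<longleftrightarrow> u = 0) \<and>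
     (\<forall>c u. N (c *\<^sub>R u) = \<bar>c\<bar> * N u) \<and>
     (\<forall>u v. N (u + v) \<le> N u + N v)"

text \<open>\<open>H\<^sub>1(\<partial>M; \<real>)\<close> is identified with \<open>\<real> \<times> \<real>\<close> through the basis \<open>\<alpha>, \<lambda>\<close>.\<close>

definition culler_shalen_norm :: "character set \<Rightarrow> real \<times> real \<Rightarrow> real" where
  "culler_shalen_norm X =
     (THE N. is_norm N \<and>
        (\<forall>p q :: int. N (of_int p, of_int q) = of_int (map_degree X (f_gamma X (peripheral p q)))))"

end

theory Submission
  imports Defs "HOL-Computational_Algebra.Formal_Laurent_Series"
    "HOL-Computational_Algebra.Fundamental_Theorem_Algebra"
begin

text \<open>
  With \<open>y = 2 z - 1 - x\<^sup>2\<close> the curve becomes \<open>y\<^sup>2 = x\<^sup>4 - 6 x\<^sup>2 + 5\<close>, a double cover of the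
  \<open>x\<close>-line that is unramified over infinity. A valuation of its function field is
  determined by its centre, because the value of \<open>h\<close> or of its conjugate can be read off, and
  the product of the two is a polynomial in \<open>x\<close>; the same argument shows that the zeros and poles of
  a function balance. A regular function has poles only at the two places at infinity, so its degree
  is the sum of the pole orders there. If the meridian has the eigenvalue \<open>m\<close> with
  \<open>x = m + 1/m\<close>, then the longitude has trace \<open>x\<^sup>4 - 5 x\<^sup>2 + 2\<close>, so its eigenvalue \<open>l\<close> has at
  these places the order of \<open>m\<^sup>4\<close> and of \<open>m\<^sup>-\<^sup>4\<close>. As \<open>f\<^sub>\<gamma> = (m\<^sup>p l\<^sup>q - m\<^sup>-\<^sup>p l\<^sup>-\<^sup>q)\<^sup>2\<close>, the pole
  orders are \<open>2 |p + 4 q|\<close> and \<open>2 |p - 4 q|\<close>.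

  The component is identified through the relation \<open>w A - B w = (z\<^sup>2 - (1 + x\<^sup>2) z + 2 x\<^sup>2 - 1) (A - B)\<close>,
  which makes the character variety the union of the curve and the curve \<open>z = x\<^sup>2 - 2\<close>. On the latter
  two commutators commute that do not commute in the group, so no faithful character lies on it.
\<close>

(* The theory of Laurent series leaves the notation $ for power series coefficients switched on,
   where it clashes with the one for vectors. *)
unbundle no Formal_Power_Series.fps_syntax

section \<open>The coordinate ring of the curve\<close>

text \<open>The points of the smooth model are given only as valuations, so every centre needs at
  most one valuation and at least one. Uniqueness comes from a value formula up to a common factor,
  which normalization forces to be 1. Existence comes from points of the curve with Laurent series
  coordinates. A missing place would spoil the count in a fibre, and the degree exists only if all
  fibres have the same count.

  The quartic is the discriminant of the equation in z, and it equals (x^2 - 3)^2 - 4, which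
  explains the constants at infinity. The longitude has its eigenvalues in the field of m and y
  because its trace L satisfies L^2 - 4 = (m^2 - m^-2)^2 y^2. The peripheral traces follow from tr(g
  h) + tr(g h^-1) = tr g tr h and four initial values, of which only the trace of \<alpha> \<lambda>
  shows which eigenvalue of the longitude belongs to m.

  The curve z = x^2 - 2 carries the reducible characters, since tr [A, B] - 2 = (z - 2) (z - x^2 +
  2). Degrees prescribe the norm at integer points only; homogeneity and rounding determine the
  rest.\<close>

definition quartic :: "complex poly" where
  "quartic = [:5, 0, -6, 0, 1:]"

text \<open>\<open>CF a b\<close> is the function \<open>a(x) + b(x) y\<close>, where \<open>y\<^sup>2 = quartic(x)\<close>.\<close>

datatype curve_fun = CF (even_part: "complex poly") (odd_part: "complex poly")

instantiation curve_fun :: comm_ring_1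
begin

definition "0 = CF 0 0"
definition "1 = CF 1 0"
definition "f + g = CF (even_part f + even_part g) (odd_part f + odd_part g)"
definition "f - g = CF (even_part f - even_part g) (odd_part f - odd_part g)"
definition "- f = CF (- even_part f) (- odd_part f)"
definition "f * g =
  CF (even_part f * even_part g + quartic * odd_part f * odd_part g)
     (even_part f * odd_part g + odd_part f * even_part g)"

instance
  by standard
    (auto simp: zero_curve_fun_def one_curve_fun_def plus_curve_fun_def minus_curve_fun_def
      uminus_curve_fun_def times_curve_fun_def algebra_simps)

end

lemma curve_fun_arith [simp]:
  "CF a b + CF c d = CF (a + c) (b + d)"
  "CF a b - CF c d = CF (a - c) (b - d)"
  "- CF a b = CF (- a) (- b)"
  "CF a b * CF c d = CF (a * c + quartic * b * d) (a * d + b * c)"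
  "CF a b = 0 \<longleftrightarrow> a = 0 \<and> b = 0"
  "CF a b = 1 \<longleftrightarrow> a = 1 \<and> b = 0"
  by (auto simp: zero_curve_fun_def one_curve_fun_def plus_curve_fun_def minus_curve_fun_def
      uminus_curve_fun_def times_curve_fun_def)

lemma quartic_nonzero [simp]: "quartic \<noteq> 0"
  by (simp add: quartic_def)

lemma poly_quartic: "poly quartic x = x ^ 4 - 6 * x ^ 2 + 5"
  by (simp add: quartic_def algebra_simps power2_eq_square power4_eq_xxxx)

text \<open>The derivative 4 x^3 - 12 x vanishes only for x = 0 or x^2 = 3, where the quartic is 5
  or -4. Simple roots give both the irreducibility of the curve and ramification index 2 at its
  branch points.\<close>

lemma order_quartic:
  assumes "poly quartic x = 0"
  shows "order x quartic = 1"
proof -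
  have "rsquarefree quartic"
    unfolding rsquarefree_roots
  proof (intro allI notI)
    fix a
    assume "poly quartic a = 0 \<and> poly (pderiv quartic) a = 0"
    then have 1: "a ^ 4 - 6 * a ^ 2 + 5 = 0" and 2: "4 * a ^ 3 - 12 * a = 0"
      by (simp_all add: poly_quartic)
         (simp add: quartic_def pderiv_pCons algebra_simps power3_eq_cube)
    from 2 have "a * (a ^ 2 - 3) = 0"
      by algebra
    then have "a = 0 \<or> a ^ 2 = 3" by simp
    then show False
    proof
      assume "a ^ 2 = 3"
      moreover have "a ^ 4 = (a ^ 2) ^ 2" by simp
      ultimately show False using 1 by simp
    qed (use 1 in simp)
  qed
  then have "order x quartic = 0 \<or> order x quartic = 1" by (simp add: rsquarefree_def)
  moreover have "order x quartic \<noteq> 0" using assms by (simp add: order_root)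
  ultimately show ?thesis by simp
qed

definition conj_fun :: "curve_fun \<Rightarrow> curve_fun" where
  "conj_fun h = CF (even_part h) (- odd_part h)"

definition curve_norm :: "curve_fun \<Rightarrow> complex poly" where
  "curve_norm h = even_part h ^ 2 - quartic * odd_part h ^ 2"

lemma mult_conj_fun: "h * conj_fun h = CF (curve_norm h) 0"
  by (cases h) (simp add: conj_fun_def curve_norm_def power2_eq_square algebra_simps)

lemma conj_fun_simps [simp]:
  "conj_fun (CF a b) = CF a (- b)"
  "conj_fun (conj_fun h) = h"
  "conj_fun (g + h) = conj_fun g + conj_fun h"
  "conj_fun (g * h) = conj_fun g * conj_fun h"
  "conj_fun 0 = 0"
  "conj_fun h = 0 \<longleftrightarrow> h = 0"
  by (cases g; cases h; auto simp: conj_fun_def zero_curve_fun_def)+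

text \<open>At the root 1 of the quartic, a^2 has even order and quartic * b^2 has odd order, so y
  is not a rational function of x. This is what makes \<open>curve_fun\<close> a domain, and hence
  the curve irreducible.\<close>

lemma curve_norm_eq_0_iff [simp]: "curve_norm h = 0 \<longleftrightarrow> h = 0"
proof
  assume eq: "curve_norm h = 0"
  obtain a b where h: "h = CF a b" by (cases h)
  have ab: "a ^ 2 = quartic * b ^ 2" using eq by (simp add: h curve_norm_def)
  have "b = 0"
  proof (rule ccontr)
    assume b: "b \<noteq> 0"
    then have "a \<noteq> 0" using ab by auto
    have "order 1 (a ^ 2) = 2 * order 1 a"
      using \<open>a \<noteq> 0\<close> by (simp add: power2_eq_square order_mult)
    moreover have "order 1 (quartic * b ^ 2) = 1 + 2 * order 1 b"
      using b by (simp add: power2_eq_square order_mult order_quartic poly_quartic)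
    ultimately have "2 * order 1 a = 1 + 2 * order 1 b" using ab by metis
    then show False by presburger
  qed
  then show "h = 0" using ab by (simp add: h)
qed (simp add: curve_norm_def zero_curve_fun_def)

lemma curve_norm_mult: "curve_norm (g * h) = curve_norm g * curve_norm h"
  by (cases g; cases h) (simp add: curve_norm_def power2_eq_square algebra_simps)

instance curve_fun :: idom
proof
  fix f g :: curve_fun
  assume "f \<noteq> 0" "g \<noteq> 0"
  then have "curve_norm (f * g) \<noteq> 0"
    by (simp only: curve_norm_mult) simp
  then show "f * g \<noteq> 0" by (simp del: curve_norm_eq_0_iff add: curve_norm_def zero_curve_fun_def) auto
qed

abbreviation x_fun :: curve_fun where "x_fun \<equiv> CF [:0, 1:] 0"
abbreviation y_fun :: curve_fun where "y_fun \<equiv> CF 0 1"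
abbreviation const_fun :: "complex \<Rightarrow> curve_fun" where "const_fun c \<equiv> CF [:c:] 0"


section \<open>Places of the function field\<close>

text \<open>The clauses of \<open>smooth_model\<close>, transported to \<open>curve_fun\<close>.
  Only regular functions have values here, so a uniformizer appears as a quotient in
  \<open>v_onto\<close>.\<close>

locale curve_valuation =
  fixes v :: "curve_fun \<Rightarrow> int"
  assumes v_mult: "f \<noteq> 0 \<Longrightarrow> g \<noteq> 0 \<Longrightarrow> v (f * g) = v f + v g"
    and v_add: "f \<noteq> 0 \<Longrightarrow> g \<noteq> 0 \<Longrightarrow> f + g \<noteq> 0 \<Longrightarrow> min (v f) (v g) \<le> v (f + g)"
    and v_const: "c \<noteq> 0 \<Longrightarrow> v (const_fun c) = 0"
    and v_onto: "\<exists>f g. f \<noteq> 0 \<and> g \<noteq> 0 \<and> v f - v g = 1"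
    and v_zero: "v 0 = 0"
begin

text \<open>The value \<open>v 0 = 0\<close> is a convention, so \<open>ge k f\<close> says that \<open>v f \<ge> k\<close> with \<open>v 0 = \<infinity>\<close>.\<close>

definition ge :: "int \<Rightarrow> curve_fun \<Rightarrow> bool" where
  "ge k f \<longleftrightarrow> f = 0 \<or> k \<le> v f"

lemma ge_mono: "ge k f \<Longrightarrow> j \<le> k \<Longrightarrow> ge j f"
  by (auto simp: ge_def)

lemma ge_add: "ge k f \<Longrightarrow> ge k g \<Longrightarrow> ge k (f + g)"
  using v_add[of f g] by (cases "f = 0 \<or> g = 0 \<or> f + g = 0") (auto simp: ge_def)

lemma ge_mult: "ge j f \<Longrightarrow> ge k g \<Longrightarrow> ge (j + k) (f * g)"
  using v_mult[of f g] by (cases "f = 0 \<or> g = 0") (auto simp: ge_def)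

lemma v_one: "v 1 = 0"
  using v_const[of 1] by (simp add: one_curve_fun_def one_pCons)

lemma v_uminus: "v (- f) = v f"
proof (cases "f = 0")
  case False
  have "- f = const_fun (-1) * f" by (cases f) simp
  then show ?thesis using v_mult[of "const_fun (-1)" f] v_const[of "-1"] False by simp
qed simp

lemma ge_uminus: "ge k f \<Longrightarrow> ge k (- f)"
  by (auto simp: ge_def v_uminus)

lemma ge_diff: "ge k f \<Longrightarrow> ge k g \<Longrightarrow> ge k (f - g)"
  using ge_add[of k f "- g"] ge_uminus[of k g] by simp

lemma ge_const: "ge 0 (const_fun c)"
  using v_const[of c] by (cases "c = 0") (auto simp: ge_def)

text \<open>The term of strictly smaller value decides. The hypothesis is phrased with
  \<open>ge\<close> so that g = 0 is covered, whose conventional value 0 may well be below that of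
  f.\<close>

lemma v_add_eq:
  assumes "f \<noteq> 0" "ge (v f + 1) g"
  shows "f + g \<noteq> 0 \<and> v (f + g) = v f"
proof (cases "g = 0")
  case g: False
  then have vg: "v f < v g" using assms by (auto simp: ge_def)
  then have ne: "f + g \<noteq> 0"
    using v_uminus[of f] by (metis add.inverse_unique order_less_irrefl)
  have 1: "v f \<le> v (f + g)" using v_add[OF assms(1) g ne] vg by simp
  have "min (v (f + g)) (v (- g)) \<le> v f"
    using v_add[of "f + g" "- g"] ne g assms(1) by simp
  then show ?thesis using 1 vg ne by (auto simp: v_uminus)
qed (use assms in auto)

lemma v_power: "f \<noteq> 0 \<Longrightarrow> v (f ^ n) = int n * v f"
  by (induction n) (auto simp: v_one v_mult algebra_simps)

lemma v_unit: "f * g = const_fun c \<Longrightarrow> c \<noteq> 0 \<Longrightarrow> v f = - v g"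
  using v_mult[of f g] v_const[of c] by fastforce

end

lemma CF_pCons: "CF (pCons c p) 0 = const_fun c + x_fun * CF p 0"
  by simp

lemma CF_power: "CF (p ^ n) 0 = CF p 0 ^ n"
proof (induction n)
  case (Suc n)
  have "CF (p ^ Suc n) 0 = CF p 0 * CF (p ^ n) 0" by simp
  then show ?case using Suc by simp
qed (simp add: one_curve_fun_def)

lemma CF_split: "CF a b = CF a 0 + CF b 0 * y_fun"
  by simp

lemma poly_split: "p = [:poly p x0:] + [:- x0, 1:] * synthetic_div p x0" for p :: "'a::comm_ring_1 poly"
  using synthetic_div_correct'[of x0 p] by (simp add: add.commute)

context curve_valuation
begin

lemma conj: "curve_valuation (\<lambda>h. v (conj_fun h))"
proof
  show "\<exists>f g. f \<noteq> 0 \<and> g \<noteq> 0 \<and> v (conj_fun f) - v (conj_fun g) = 1"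
    by (metis v_onto conj_fun_simps(2,6))
  show "min (v (conj_fun f)) (v (conj_fun g)) \<le> v (conj_fun (f + g))"
    if "f \<noteq> 0" "g \<noteq> 0" "f + g \<noteq> 0" for f g
    using v_add[of "conj_fun f" "conj_fun g"] that conj_fun_simps(3,6) by metis
qed (use v_mult v_const v_zero in auto)

lemma v_norm: "h \<noteq> 0 \<Longrightarrow> v h + v (conj_fun h) = v (CF (curve_norm h) 0)"
  using v_mult[of h "conj_fun h"] by (simp add: mult_conj_fun)

lemma ge_poly: "ge 0 x_fun \<Longrightarrow> ge 0 (CF p 0)"
proof (induction p)
  case 0
  then show ?case by (simp add: ge_def)
next
  case (pCons c p)
  then show ?case
    unfolding CF_pCons[of c p]
    by (intro ge_add ge_const) (metis ge_mult add_0)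
qed

text \<open>y is integral over the polynomials in x: twice its value is the value of the
  quartic.\<close>

lemma ge_y: "ge 0 x_fun \<Longrightarrow> ge 0 y_fun"
proof -
  assume "ge 0 x_fun"
  then have "ge 0 (CF quartic 0)" by (rule ge_poly)
  moreover have "v (CF quartic 0) = v y_fun + v y_fun"
    using v_mult[of y_fun y_fun] by simp
  ultimately have "0 \<le> v y_fun" by (simp add: ge_def)
  then show ?thesis by (simp add: ge_def)
qed

lemma ge_regular:
  assumes "ge 0 x_fun"
  shows "ge 0 h"
proof (cases h)
  case (CF a b)
  show ?thesis
    unfolding CF CF_split[of a b]
    by (metis ge_add ge_mult add_0 ge_poly[OF assms] ge_y[OF assms])
qed

lemma centre_x: "0 < v (CF [:- x0, 1:] 0) \<Longrightarrow> ge 0 x_fun"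
  using ge_add[of 0 "CF [:- x0, 1:] 0" "const_fun x0"] ge_const[of x0] by (simp add: ge_def)

lemma v_poly_unit:
  assumes c: "0 < v (CF [:- x0, 1:] 0)" and p: "poly p x0 \<noteq> 0"
  shows "v (CF p 0) = 0"
proof -
  define l where "l = [:- x0, 1:]"
  define q where "q = synthetic_div p x0"
  have "ge 1 (CF l 0)" using c by (simp add: ge_def l_def)
  from ge_mult[OF this ge_poly[OF centre_x[OF c], of q]]
  have "ge (v (const_fun (poly p x0)) + 1) (CF (l * q) 0)"
    by (simp add: v_const[OF p])
  then have "v (const_fun (poly p x0) + CF (l * q) 0) = 0"
    using v_add_eq[of "const_fun (poly p x0)" "CF (l * q) 0"] p v_const[OF p]
    by (simp del: curve_fun_arith(1))
  moreover have "p = [:poly p x0:] + l * q"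
    using poly_split[of p x0] by (simp only: l_def q_def)
  then have "CF p 0 = const_fun (poly p x0) + CF (l * q) 0"
    by (metis curve_fun_arith(1) add_0)
  ultimately show ?thesis by metis
qed

lemma v_poly:
  assumes c: "0 < v (CF [:- x0, 1:] 0)" and p: "p \<noteq> 0"
  shows "v (CF p 0) = int (order x0 p) * v (CF [:- x0, 1:] 0)"
proof -
  obtain q where q: "p = [:- x0, 1:] ^ order x0 p * q" "\<not> [:- x0, 1:] dvd q"
    using order_decomp[OF p] by blast
  then have q0: "poly q x0 \<noteq> 0" by (simp add: poly_eq_0_iff_dvd)
  have "CF p 0 = CF [:- x0, 1:] 0 ^ order x0 p * CF q 0"
    by (subst q(1)) (simp add: CF_power[symmetric])
  moreover have "CF q 0 \<noteq> 0" using q0 by auto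
  moreover have "CF [:- x0, 1:] 0 ^ order x0 p \<noteq> 0" by simp
  ultimately show ?thesis
    using v_mult[of "CF [:- x0, 1:] 0 ^ order x0 p" "CF q 0"] v_poly_unit[OF c q0] by (simp add: v_power)
qed

end

section \<open>The centre of a finite place\<close>

definition eval_fun :: "curve_fun \<Rightarrow> complex \<Rightarrow> complex \<Rightarrow> complex" where
  "eval_fun h x y = poly (even_part h) x + poly (odd_part h) x * y"

context curve_valuation
begin

definition centred :: "complex \<Rightarrow> complex \<Rightarrow> bool" where
  "centred x0 y0 \<longleftrightarrow> 0 < v (CF [:- x0, 1:] 0) \<and> ge 1 (CF [:- y0:] 1)"

text \<open>Subtracting h(x0, y0) from h = a + b y leaves x - x0 times a regular function plus b(x0)
  (y - y0). Both have positive value, so h has the value of a nonzero constant.\<close>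

lemma v_eval_unit:
  assumes c: "centred x0 y0" and h: "eval_fun h x0 y0 \<noteq> 0"
  shows "v h = 0"
proof -
  obtain a b where ab: "h = CF a b" by (cases h)
  define e where "e = eval_fun h x0 y0"
  have cx: "0 < v (CF [:- x0, 1:] 0)" and cy: "ge 1 (CF [:- y0:] 1)" using c by (auto simp: centred_def)
  have x: "ge 1 (CF [:- x0, 1:] 0)" using cx by (simp add: ge_def)
  note r = ge_regular[OF centre_x[OF cx]]
  define l where "l = [:- x0, 1:]"
  define a' b' where "a' = synthetic_div a x0" and "b' = synthetic_div b x0"
  have "ge 1 (CF l 0 * CF a' b')" using ge_mult[OF x r] unfolding l_def by (metis add_0_right)
  moreover have "ge 1 (const_fun (poly b x0) * CF [:- y0:] 1)" using ge_mult[OF r cy] by (metis add_0)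
  ultimately have "ge 1 (CF l 0 * CF a' b' + const_fun (poly b x0) * CF [:- y0:] 1)" by (rule ge_add)
  moreover have "a = [:poly a x0:] + l * a'" "b = [:poly b x0:] + l * b'"
    using poly_split[of a x0] poly_split[of b x0] by (simp_all only: l_def a'_def b'_def)
  then have "CF a b = CF ([:poly a x0:] + l * a') ([:poly b x0:] + l * b')" by metis
  then have "h = const_fun e + (CF l 0 * CF a' b' + const_fun (poly b x0) * CF [:- y0:] 1)"
    by (simp add: ab e_def eval_fun_def algebra_simps)
  moreover have "e \<noteq> 0" using h by (simp add: e_def)
  ultimately show ?thesis
    using v_add_eq[of "const_fun e"] v_const[of e] by (simp del: curve_fun_arith(1-4))
qed

lemma v_poly_pos:
  assumes "p \<noteq> 0" "0 < v (CF p 0)"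
  shows "\<exists>x0. 0 < v (CF [:- x0, 1:] 0)"
  using assms
proof (induction "degree p" arbitrary: p rule: less_induct)
  case less
  show ?case
  proof (cases "degree p = 0")
    case True
    then obtain c where "p = [:c:]" by (rule degree_eq_zeroE)
    then show ?thesis using less.prems v_const[of c] by simp
  next
    case False
    then obtain r where "poly p r = 0"
      using fundamental_theorem_of_algebra[of p] constant_degree[of p] by auto
    then obtain q where q: "p = [:- r, 1:] * q" by (auto simp: poly_eq_0_iff_dvd)
    have q0: "q \<noteq> 0" using q less.prems by auto
    have "CF p 0 = CF [:- r, 1:] 0 * CF q 0" using q by simp
    then have v: "v (CF p 0) = v (CF [:- r, 1:] 0) + v (CF q 0)"
      using v_mult[of "CF [:- r, 1:] 0" "CF q 0"] q0 by simp
    have deg: "degree q < degree p" using q q0 by (subst q, subst degree_mult_eq) auto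
    show ?thesis
    proof (cases "0 < v (CF q 0)")
      case True
      then show ?thesis using less.hyps[OF deg q0] by blast
    next
      case False
      then show ?thesis using v less.prems by (intro exI[of _ r]) simp
    qed
  qed
qed

text \<open>Normalization yields some f of positive value. Its conjugate has no pole, so the norm of
  f has positive value too, and the norm is a polynomial in x with a linear factor of positive
  value.\<close>

lemma finite_centre:
  assumes x: "ge 0 x_fun"
  shows "\<exists>x0. 0 < v (CF [:- x0, 1:] 0)"
proof -
  note r = ge_regular[OF x]
  obtain f g where fg: "f \<noteq> 0" "g \<noteq> 0" "v f - v g = 1" using v_onto by blast
  have "ge 0 g" by (rule r)
  then have vf: "0 < v f" using fg by (auto simp: ge_def)
  have "0 \<le> v (conj_fun f)" using r[of "conj_fun f"] fg by (auto simp: ge_def)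
  then have N: "0 < v (CF (curve_norm f) 0)" using v_norm[OF fg(1)] vf by simp
  have nz: "curve_norm f \<noteq> 0" using fg by simp
  from v_poly_pos[OF nz N] show ?thesis .
qed

text \<open>(y - y0) (y + y0) is the quartic minus its value at x0, hence divisible by x - x0; one
  of the two factors must then have positive value.\<close>

lemma centre_y:
  assumes x0: "0 < v (CF [:- x0, 1:] 0)" and y0: "y0 ^ 2 = poly quartic x0"
  shows "centred x0 y0 \<or> centred x0 (- y0)"
proof -
  note r = ge_regular[OF centre_x[OF x0]]
  define l where "l = [:- x0, 1:]"
  define q where "q = synthetic_div quartic x0"
  have "quartic = [:poly quartic x0:] + l * q"
    using poly_split[of quartic x0] by (simp only: l_def q_def)
  then have "[:- poly quartic x0:] + quartic = l * q"
    by (metis minus_pCons minus_zero minus_add_cancel)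
  then have "CF [:- y0:] 1 * CF [:y0:] 1 = CF l 0 * CF q 0"
    using y0 by (simp add: power2_eq_square)
  moreover have "ge 1 (CF l 0)" using x0 by (simp add: ge_def l_def)
  then have "ge 1 (CF l 0 * CF q 0)" using ge_mult[OF _ r] by (metis add_0_right)
  ultimately have "1 \<le> v (CF [:- y0:] 1 * CF [:y0:] 1)"
    using no_zero_divisors[of "CF [:- y0:] 1" "CF [:y0:] 1"] by (auto simp: ge_def simp del: curve_fun_arith(4))
  then have "1 \<le> v (CF [:- y0:] 1) + v (CF [:y0:] 1)"
    using v_mult[of "CF [:- y0:] 1" "CF [:y0:] 1"] by (simp del: curve_fun_arith(4))
  then have "ge 1 (CF [:- y0:] 1) \<or> ge 1 (CF [:y0:] 1)" by (auto simp: ge_def)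
  then show ?thesis
    using x0 by (auto simp: centred_def)
qed

end

section \<open>Values at infinity and uniqueness of places\<close>

context curve_valuation
begin

text \<open>In a Horner step the product with x has negative value and outweighs the constant, so
  only the leading term counts.\<close>

lemma v_poly_infinite:
  assumes x: "v x_fun < 0" and p: "p \<noteq> 0"
  shows "v (CF p 0) = int (degree p) * v x_fun"
  using p
proof (induction p)
  case (pCons c p)
  show ?case
  proof (cases "p = 0")
    case True
    then show ?thesis using pCons.prems v_const[of c] by simp
  next
    case False
    have vp: "v (x_fun * CF p 0) = (1 + int (degree p)) * v x_fun"
      using v_mult[of x_fun "CF p 0"] pCons.IH[OF False] False
      by (simp add: algebra_simps del: curve_fun_arith(4))
    have "(1 + int (degree p)) * v x_fun < 0" using x by (simp add: mult_less_0_iff)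
    then have "ge (v (x_fun * CF p 0) + 1) (const_fun c)"
      using ge_mono[OF ge_const] vp by simp
    moreover have "x_fun * CF p 0 \<noteq> 0" using False by simp
    ultimately have "v (x_fun * CF p 0 + const_fun c) = v (x_fun * CF p 0)"
      using v_add_eq by blast
    then have "v (CF (pCons c p) 0) = v (x_fun * CF p 0)"
      by (metis CF_pCons add.commute)
    then show ?thesis using False vp by (simp del: curve_fun_arith)
  qed
qed simp

end

text \<open>If the value of each h is e v times a number depending on h alone, then e v divides
  every difference of values. One such difference is 1, so e v = 1 and the numbers are the values
  themselves.\<close>

lemma place_unique:
  fixes e :: "(curve_fun \<Rightarrow> int) \<Rightarrow> int"
  assumes formula: "\<And>h. h \<noteq> 0 \<Longrightarrow> \<exists>c. \<forall>v. P v \<longrightarrow> v h = e v * c"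
    and val: "\<And>v. P v \<Longrightarrow> curve_valuation v \<and> 0 < e v"
  shows "P v \<Longrightarrow> e v = 1" and "P v \<Longrightarrow> P w \<Longrightarrow> v = w"
proof -
  have one: "e v = 1" if v: "P v" for v
  proof -
    interpret curve_valuation v using val[OF v] by simp
    obtain f g where fg: "f \<noteq> 0" "g \<noteq> 0" "v f - v g = 1" using v_onto by blast
    obtain c d where "v f = e v * c" "v g = e v * d"
      using formula[OF fg(1)] formula[OF fg(2)] v by blast
    then have "e v dvd 1" using fg(3) by (metis dvd_triv_left dvd_diff)
    then show ?thesis using val[OF v] by simp
  qed
  show "P v \<Longrightarrow> e v = 1" by (rule one)
  assume P: "P v" "P w"
  show "v = w"
  proof
    fix h
    show "v h = w h"
    proof (cases "h = 0")
      case True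
      then show ?thesis using P val by (simp add: curve_valuation.v_zero)
    next
      case False
      then show ?thesis using formula[OF False] P one by metis
    qed
  qed
qed

lemma split_common_root:
  fixes a b :: "'a::idom poly"
  assumes "a \<noteq> 0 \<or> b \<noteq> 0"
  shows "\<exists>g a' b'. g \<noteq> 0 \<and> a = g * a' \<and> b = g * b' \<and> (poly a' r \<noteq> 0 \<or> poly b' r \<noteq> 0)"
  using assms
proof (induction "degree a + degree b" arbitrary: a b rule: less_induct)
  case less
  show ?case
  proof (cases "poly a r = 0 \<and> poly b r = 0")
    case False
    then show ?thesis by (intro exI[of _ 1] exI[of _ a] exI[of _ b]) auto
  next
    case True
    then obtain c d where cd: "a = [:- r, 1:] * c" "b = [:- r, 1:] * d"
      unfolding poly_eq_0_iff_dvd dvd_def by blast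
    then have ne: "c \<noteq> 0 \<or> d \<noteq> 0" using less.prems by auto
    have deg: "degree ([:- r, 1:] * p) = (if p = 0 then 0 else Suc (degree p))" for p :: "'a poly"
      by (cases "p = 0") (simp_all add: degree_mult_eq del: mult_pCons_left)
    have "degree c + degree d < degree a + degree b"
      using ne by (auto simp: cd deg simp del: mult_pCons_left)
    from less.hyps[OF this ne] obtain g c' d' where
      "g \<noteq> 0" "c = g * c'" "d = g * d'" "poly c' r \<noteq> 0 \<or> poly d' r \<noteq> 0" by blast
    then show ?thesis
      by (intro exI[of _ "[:- r, 1:] * g"] exI[of _ c'] exI[of _ d'])
        (auto simp: cd mult.assoc simp del: mult_pCons_left)
  qed
qed

text \<open>Once the common powers of x - x0 are split off, a' + b' y0 and a' - b' y0 cannot both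
  vanish at x0, because y0 is nonzero. So h' or its conjugate has value 0, and in the second case h'
  has the value of its norm.\<close>

lemma unramified_formula:
  assumes y0: "y0 \<noteq> 0" and h: "h \<noteq> 0"
  shows "\<exists>c. \<forall>v. curve_valuation v \<and> curve_valuation.centred v x0 y0 \<longrightarrow> v h = v (CF [:- x0, 1:] 0) * c"
proof -
  obtain a b where ab: "h = CF a b" by (cases h)
  obtain g a' b' where g: "g \<noteq> 0" and a': "a = g * a'" "b = g * b'"
    and ne: "poly a' x0 \<noteq> 0 \<or> poly b' x0 \<noteq> 0"
    using split_common_root[of a b x0] h by (auto simp: ab)
  define h' where "h' = CF a' b'"
  have h': "h = CF g 0 * h'" by (simp add: ab a' h'_def)
  then have h'0: "h' \<noteq> 0" using h by auto
  have ev: "eval_fun h' x0 y0 \<noteq> 0 \<or> eval_fun (conj_fun h') x0 y0 \<noteq> 0"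
    using y0 ne by (auto simp: eval_fun_def h'_def)
  show ?thesis
  proof (intro exI allI impI)
    fix v
    assume v: "curve_valuation v \<and> curve_valuation.centred v x0 y0"
    then interpret curve_valuation v by simp
    have c: "0 < v (CF [:- x0, 1:] 0)" using v by (simp add: centred_def)
    have "v h' = v (CF [:- x0, 1:] 0) *
        (if eval_fun h' x0 y0 \<noteq> 0 then 0 else int (order x0 (curve_norm h')))"
    proof (cases "eval_fun h' x0 y0 = 0")
      case True
      then have "v (conj_fun h') = 0" using ev v_eval_unit v by blast
      then show ?thesis using True v_norm[OF h'0] v_poly[OF c, of "curve_norm h'"] h'0 by simp
    qed (use v v_eval_unit in auto)
    moreover have "v h = v (CF g 0) + v h'" using v_mult[of "CF g 0" h'] g h'0 h' by simp
    ultimately show "v h = v (CF [:- x0, 1:] 0) * (int (order x0 g) +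
        (if eval_fun h' x0 y0 \<noteq> 0 then 0 else int (order x0 (curve_norm h'))))"
      using v_poly[OF c g] by (simp add: algebra_simps)
  qed
qed

context curve_valuation
begin

text \<open>The quartic is y^2 and has a simple zero at x0, so x - x0 has the value of y^2.\<close>

lemma ramified_uniformizer:
  assumes x0: "poly quartic x0 = 0" and c: "centred x0 0"
  shows "v (CF [:- x0, 1:] 0) = 2 * v y_fun" "0 < v y_fun"
proof -
  have c': "0 < v (CF [:- x0, 1:] 0)" using c by (simp add: centred_def)
  have "v y_fun + v y_fun = v (CF quartic 0)" using v_mult[of y_fun y_fun] by simp
  also have "\<dots> = v (CF [:- x0, 1:] 0)" using v_poly[OF c', of quartic] order_quartic[OF x0] by simp
  finally show "v (CF [:- x0, 1:] 0) = 2 * v y_fun" by simp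
  with c' show "0 < v y_fun" by simp
qed

end

text \<open>In units of the value of y, the even part of h has even value and the odd part odd
  value. They never tie, so the smaller one is the value of h.\<close>

lemma ramified_formula:
  assumes x0: "poly quartic x0 = 0" and h: "h \<noteq> 0"
  shows "\<exists>c. \<forall>v. curve_valuation v \<and> curve_valuation.centred v x0 0 \<longrightarrow> v h = v y_fun * c"
proof -
  obtain a b where ab: "h = CF a b" by (cases h)
  define A where "A = 2 * int (order x0 a)"
  define B where "B = 2 * int (order x0 b) + 1"
  have AB: "A \<noteq> B" unfolding A_def B_def by presburger
  have split: "h = CF a 0 + CF b 0 * y_fun" "h = CF b 0 * y_fun + CF a 0" by (simp_all add: ab)
  show ?thesis
  proof (intro exI allI impI)
    fix v
    assume v: "curve_valuation v \<and> curve_valuation.centred v x0 0"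
    then interpret curve_valuation v by simp
    have c: "0 < v (CF [:- x0, 1:] 0)" using v by (simp add: centred_def)
    have e: "v (CF [:- x0, 1:] 0) = 2 * v y_fun" "0 < v y_fun"
      using ramified_uniformizer[OF x0] v by auto
    have va: "v (CF a 0) = v y_fun * A" if "a \<noteq> 0"
      using v_poly[OF c that] e(1) by (simp add: A_def)
    have vb: "v (CF b 0 * y_fun) = v y_fun * B" if "b \<noteq> 0"
      using v_mult[of "CF b 0" y_fun] v_poly[OF c that] e(1) that
      by (simp add: B_def algebra_simps del: curve_fun_arith(4))
    consider "b = 0" | "a = 0" | "a \<noteq> 0" "b \<noteq> 0" "A < B" | "a \<noteq> 0" "b \<noteq> 0" "B < A"
      using AB by linarith
    then show "v h = v y_fun * (if b = 0 then A else if a = 0 then B else min A B)"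
    proof cases
      case 1
      then show ?thesis using va h ab by simp
    next
      case 2
      then show ?thesis using vb h ab by simp
    next
      case 3
      then have "v (CF a 0) < v (CF b 0 * y_fun)" using va vb e(2) by (simp del: curve_fun_arith(4))
      then have "v h = v (CF a 0)" unfolding split(1)
        using v_add_eq[of "CF a 0" "CF b 0 * y_fun"] 3 by (simp add: ge_def del: curve_fun_arith(1,4))
      then show ?thesis using 3 va by simp
    next
      case 4
      then have "v (CF b 0 * y_fun) < v (CF a 0)" using va vb e(2) by (simp del: curve_fun_arith(4))
      moreover have "CF b 0 * y_fun \<noteq> 0" using 4 by simp
      ultimately have "v h = v (CF b 0 * y_fun)" unfolding split(2)
        using v_add_eq[of "CF b 0 * y_fun" "CF a 0"] by (simp add: ge_def del: curve_fun_arith)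
      then show ?thesis using 4 vb by (simp del: curve_fun_arith)
    qed
  qed
qed

text \<open>The sign s selects the branch on which y is close to s (x^2 - 3). There y - s x^2, which
  is \<open>CF [:0, 0, - s:] 1\<close>, stays bounded.\<close>

definition at_infinity :: "complex \<Rightarrow> (curve_fun \<Rightarrow> int) \<Rightarrow> bool" where
  "at_infinity s v \<longleftrightarrow> v x_fun < 0 \<and> curve_valuation.ge v 0 (CF [:0, 0, - s:] 1)"

text \<open>With the bounded function w = y - s x^2 one has h = A s + b w, and the conjugate of h is
  A (- s) - b w. As A s - A (- s) = 2 s x^2 b has larger degree than b, one of A s and A (- s)
  dominates b w, so the value of h or of its conjugate is known; the norm supplies the
  other.\<close>

lemma infinite_formula:
  assumes s: "s = 1 \<or> s = -1" and h: "h \<noteq> 0"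
  shows "\<exists>c. \<forall>v. curve_valuation v \<and> at_infinity s v \<longrightarrow> v h = - v x_fun * c"
proof -
  obtain a b where ab: "h = CF a b" by (cases h)
  define A where "A = (\<lambda>s. a + [:0, 0, s:] * b)"
  define w where "w = CF [:0, 0, - s:] 1"
  have h1: "h = CF (A s) 0 + CF b 0 * w" by (simp add: ab A_def w_def)
  have h2: "conj_fun h = CF (A (- s)) 0 + CF (- b) 0 * w" by (simp add: ab A_def w_def)
  have AA: "A s + (- A (- s)) = [:0, 0, 2 * s:] * b"
  proof -
    have "[:0, 0, 2 * s:] = [:0, 0, s:] - [:0, 0, - s:]" by simp
    then show ?thesis unfolding A_def by (metis add_diff_cancel_left add_uminus_conv_diff left_diff_distrib)
  qed
  have deg: "b \<noteq> 0 \<Longrightarrow> degree b < degree (A s) \<or> degree b < degree (A (- s))"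
  proof (rule ccontr)
    assume "b \<noteq> 0" and n: "\<not> (degree b < degree (A s) \<or> degree b < degree (A (- s)))"
    then have "degree (A s + (- A (- s))) \<le> degree b" by (intro degree_add_le) auto
    moreover have "degree ([:0, 0, 2 * s:] * b) = degree b + 2"
      using \<open>b \<noteq> 0\<close> s by (subst degree_mult_eq) auto
    ultimately show False using AA by simp
  qed
  \<comment> \<open>The last case is the value of the norm minus that of the conjugate, in units of
    the pole order of x.\<close>
  define c where "c = (if b = 0 then - int (degree a)
    else if degree b < degree (A s) then - int (degree (A s))
    else int (degree (A (- s))) - int (degree (curve_norm h)))"
  show ?thesis
  proof (intro exI allI impI)
    fix v
    assume v: "curve_valuation v \<and> at_infinity s v"
    then interpret curve_valuation v by simp
    have x: "v x_fun < 0" and w: "ge 0 w" using v by (auto simp: at_infinity_def w_def)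
    have dom: "v (CF p 0 + CF q 0 * w) = int (degree p) * v x_fun"
      if "degree q < degree p" for p q
    proof -
      have "ge (int (degree q) * v x_fun) (CF q 0)"
        using v_poly_infinite[OF x, of q] by (cases "q = 0") (auto simp: ge_def)
      from ge_mult[OF this w] have "ge (int (degree q) * v x_fun) (CF q 0 * w)" by simp
      moreover have "int (degree p) * v x_fun < int (degree q) * v x_fun"
        using that x by simp
      moreover have p: "p \<noteq> 0" using that by auto
      ultimately have "ge (v (CF p 0) + 1) (CF q 0 * w)"
        using v_poly_infinite[OF x p] by (auto intro: ge_mono)
      then show ?thesis using v_add_eq[of "CF p 0"] p v_poly_infinite[OF x p] by simp
    qed
    show "v h = - v x_fun * c"
    proof (cases "b = 0")
      case True
      then show ?thesis using v_poly_infinite[OF x, of a] h by (auto simp: ab c_def)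
    next
      case b: False
      show ?thesis
      proof (cases "degree b < degree (A s)")
        case True
        then show ?thesis using dom[OF True] b h1 by (simp add: c_def)
      next
        case False
        then have d: "degree (- b) < degree (A (- s))" using deg b by auto
        then have "v (conj_fun h) = int (degree (A (- s))) * v x_fun" using dom[OF d] h2 by simp
        then show ?thesis
          using v_norm[OF h] v_poly_infinite[OF x, of "curve_norm h"] h b False
          by (simp add: c_def algebra_simps)
      qed
    qed
  qed
qed

context curve_valuation
begin

text \<open>The two places at infinity come from the factorisation
  \<open>(y - (x\<^sup>2 - 3)) (y + (x\<^sup>2 - 3)) = - 4\<close>.\<close>

lemma infinite_centre:
  assumes x: "v x_fun < 0"
  shows "at_infinity 1 v \<or> at_infinity (-1) v"
proof -
  define f g where "f = CF [:3, 0, -1:] 1" and "g = CF [:-3, 0, 1:] 1"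
  have fg: "f \<noteq> 0" "g \<noteq> 0" by (simp_all add: f_def g_def)
  have "f * g = const_fun (-4)"
    by (simp add: f_def g_def quartic_def)
  from v_unit[OF this] have vfg: "v f = - v g" by simp
  \<comment> \<open>f - g = 6 - 2 x^2 has a pole, so f or g has one; the constant product makes the
    other one vanish.\<close>
  have "f + (- g) = CF [:6, 0, -2:] 0" by (simp add: f_def g_def)
  then have "v (f + (- g)) < 0" "f + (- g) \<noteq> 0" using v_poly_infinite[OF x, of "[:6, 0, -2:]"] x by simp_all
  then have "v f < 0 \<or> v g < 0" using v_add[of f "- g"] fg v_uminus[of g] by auto
  then have "0 < v f \<or> 0 < v g" using vfg by auto
  then have "ge 0 f \<or> ge 0 g" by (auto simp: ge_def)
  moreover have "CF [:0, 0, -1:] 1 = f + const_fun (-3)" "CF [:0, 0, 1:] 1 = g + const_fun 3"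
    by (simp_all add: f_def g_def)
  ultimately show ?thesis
    using x ge_add[OF _ ge_const] by (fastforce simp: at_infinity_def simp del: curve_fun_arith)
qed

end

section \<open>Existence of places from Laurent series points\<close>

definition poly_fls :: "complex poly \<Rightarrow> complex fls \<Rightarrow> complex fls" where
  "poly_fls p X = poly (map_poly fls_const p) X"

lemma poly_fls_pCons [simp]: "poly_fls (pCons c p) X = fls_const c + X * poly_fls p X"
  by (simp add: poly_fls_def map_poly_pCons)

lemma poly_fls_0 [simp]: "poly_fls 0 X = 0"
  by (simp add: poly_fls_def)

lemma poly_fls_1 [simp]: "poly_fls 1 X = 1"
  by (simp add: one_pCons)

lemma poly_fls_add [simp]: "poly_fls (p + q) X = poly_fls p X + poly_fls q X"
  by (induction p q rule: poly_induct2) (simp_all add: algebra_simps flip: fls_plus_const)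

lemma poly_fls_smult [simp]: "poly_fls (smult c p) X = fls_const c * poly_fls p X"
  by (induction p) (simp_all add: algebra_simps flip: fls_const_mult_const)

lemma poly_fls_mult [simp]: "poly_fls (p * q) X = poly_fls p X * poly_fls q X"
  by (induction p) (simp_all add: algebra_simps)

lemma poly_fls_uminus [simp]: "poly_fls (- p) X = - poly_fls p X"
  using poly_fls_smult[of "-1" p X] by simp

lemma poly_fls_fps:
  "\<exists>f. poly_fls p (fps_to_fls F) = fps_to_fls f \<and> fps_nth f 0 = poly p (fps_nth F 0)"
proof (induction p)
  case 0
  then show ?case by (intro exI[of _ 0]) simp
next
  case (pCons c p)
  then obtain f where "poly_fls p (fps_to_fls F) = fps_to_fls f" "fps_nth f 0 = poly p (fps_nth F 0)" by blast
  then show ?case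
    by (intro exI[of _ "fps_const c + F * f"]) (simp add: fls_times_fps_to_fls)
qed

text \<open>Over the complex numbers p splits into linear factors, and no X - r vanishes for a
  nonconstant X.\<close>

lemma poly_fls_nonzero:
  assumes X: "\<And>c. X \<noteq> fls_const c" and p: "p \<noteq> 0"
  shows "poly_fls p X \<noteq> 0"
  using p
proof (induction "degree p" arbitrary: p rule: less_induct)
  case less
  show ?case
  proof (cases "degree p = 0")
    case True
    then obtain c where "p = [:c:]" by (rule degree_eq_zeroE)
    then show ?thesis using less.prems by simp
  next
    case False
    then obtain r where "poly p r = 0"
      using fundamental_theorem_of_algebra[of p] constant_degree[of p] by auto
    then obtain q where q: "p = [:- r, 1:] * q" by (auto simp: poly_eq_0_iff_dvd)
    have q0: "q \<noteq> 0" using q less.prems by auto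
    have deg: "degree q < degree p" using q q0 by (subst q, subst degree_mult_eq) auto
    have "poly_fls p X = (X - fls_const r) * poly_fls q X"
      unfolding q poly_fls_mult by simp
    then show ?thesis using less.hyps[OF deg q0] X[of r] by simp
  qed
qed

definition embed :: "complex fls \<Rightarrow> complex fls \<Rightarrow> curve_fun \<Rightarrow> complex fls" where
  "embed X Y h = poly_fls (even_part h) X + poly_fls (odd_part h) X * Y"

lemma embed_CF [simp]: "embed X Y (CF a b) = poly_fls a X + poly_fls b X * Y"
  by (simp add: embed_def)

text \<open>A point of the curve over the field of Laurent series. Since its x-coordinate is not
  constant, evaluation there is injective and the order of a series pulls back to the function
  field.\<close>

locale series_point =
  fixes X Y :: "complex fls"
  assumes eq: "Y ^ 2 = poly_fls quartic X" and nonconst: "X \<noteq> fls_const c"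
begin

lemma embed_add [simp]: "embed X Y (g + h) = embed X Y g + embed X Y h"
  by (cases g; cases h) (simp add: algebra_simps)

lemma embed_mult [simp]: "embed X Y (g * h) = embed X Y g * embed X Y h"
  by (cases g; cases h) (simp add: eq[symmetric] power2_eq_square algebra_simps)

lemma embed_uminus [simp]: "embed X Y (- h) = - embed X Y h"
  by (cases h) simp

lemma embed_diff [simp]: "embed X Y (g - h) = embed X Y g - embed X Y h"
  using embed_add[of g "- h"] by (simp del: embed_add)

lemma embed_0 [simp]: "embed X Y 0 = 0"
  by (simp add: embed_def zero_curve_fun_def)

lemma embed_eq_0_iff [simp]: "embed X Y h = 0 \<longleftrightarrow> h = 0"
proof
  assume "embed X Y h = 0"
  then have "embed X Y (h * conj_fun h) = 0" by simp
  then have "poly_fls (curve_norm h) X = 0"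
    unfolding mult_conj_fun by simp
  then show "h = 0"
    using poly_fls_nonzero[OF nonconst, of "curve_norm h"] by auto
qed simp

lemma curve_valuation:
  assumes "f \<noteq> 0" "g \<noteq> 0" "fls_subdegree (embed X Y f) - fls_subdegree (embed X Y g) = 1"
  shows "curve_valuation (\<lambda>h. fls_subdegree (embed X Y h))"
proof
  show "min (fls_subdegree (embed X Y f)) (fls_subdegree (embed X Y g))
      \<le> fls_subdegree (embed X Y (f + g))" if "f \<noteq> 0" "g \<noteq> 0" "f + g \<noteq> 0" for f g
    using that fls_plus_subdegree[of "embed X Y f" "embed X Y g"] embed_eq_0_iff[of "f + g"]
    by (simp del: embed_eq_0_iff)
qed (use assms in auto)

end

lemma fps_sqrt_exists:
  fixes a :: "complex fps"
  assumes "fps_nth a 0 = c ^ 2" "c \<noteq> 0"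
  obtains s where "s ^ 2 = a" "fps_nth s 0 = c"
proof
  show "fps_radical (\<lambda>_ _. c) 2 a ^ 2 = a"
    using power_radical[of a "\<lambda>_ _. c" 1] assms by (simp add: numeral_2_eq_2)
  show "fps_nth (fps_radical (\<lambda>_ _. c) 2 a) 0 = c" by simp
qed

text \<open>With x = x0 + t the quartic becomes a power series with the nonzero constant term y0^2,
  and it has a square root with constant term y0.\<close>

lemma unramified_exists:
  assumes y0: "y0 ^ 2 = poly quartic x0" "y0 \<noteq> 0"
  shows "\<exists>v. curve_valuation v \<and> curve_valuation.centred v x0 y0"
proof -
  define F where "F = fps_const x0 + fps_X"
  obtain a where a: "poly_fls quartic (fps_to_fls F) = fps_to_fls a" "fps_nth a 0 = poly quartic (fps_nth F 0)"
    using poly_fls_fps by blast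
  obtain s where s: "s ^ 2 = a" "fps_nth s 0 = y0"
    using fps_sqrt_exists[of a y0] a(2) y0 by (auto simp: F_def)
  define X Y where "X = fps_to_fls F" and "Y = fps_to_fls s"
  have X: "X = fls_const x0 + fls_X" by (simp add: X_def F_def)
  interpret series_point X Y
  proof
    show "Y ^ 2 = poly_fls quartic X" by (simp add: Y_def X_def a flip: fps_to_fls_power s(1))
    have "fls_nth X 1 = 1" by (simp add: X)
    then show "X \<noteq> fls_const c" for c by auto
  qed
  have x: "embed X Y (CF [:- x0, 1:] 0) = fls_X" by (simp add: X)
  have y: "embed X Y (CF [:- y0:] 1) = fps_to_fls (s - fps_const y0)" by (simp add: Y_def)
  \<comment> \<open>y - y0 is a nonzero function, so its series is nonzero; having no constant term,
    it has positive order.\<close>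
  have "s - fps_const y0 \<noteq> 0" using embed_eq_0_iff[of "CF [:- y0:] 1"] unfolding y by (simp only: fps_to_fls_eq_0_iff) simp
  then have sub: "0 < subdegree (s - fps_const y0)"
    using s(2) by (simp add: subdegree_pos_iff)
  have "embed X Y 1 = 1" by (simp add: one_curve_fun_def)
  then have v: "curve_valuation (\<lambda>h. fls_subdegree (embed X Y h))"
    using curve_valuation[of "CF [:- x0, 1:] 0" 1] unfolding x by simp
  have "fls_subdegree (embed X Y (CF [:- y0:] 1)) = int (subdegree (s - fps_const y0))"
    unfolding y by (rule fls_subdegree_fls_to_fps)
  then show ?thesis
    using sub x by (intro exI[of _ "\<lambda>h. fls_subdegree (embed X Y h)"] conjI v)
      (simp add: curve_valuation.centred_def[OF v] curve_valuation.ge_def[OF v] del: embed_CF)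
qed

text \<open>With x = x0 + t^2 the quartic is t^2 q(x), where q does not vanish at x0, so y = t
  sqrt(q(x)) is a series of order 1.\<close>

lemma ramified_exists:
  assumes x0: "poly quartic x0 = 0"
  shows "\<exists>v. curve_valuation v \<and> curve_valuation.centred v x0 0"
proof -
  obtain q where q: "quartic = [:- x0, 1:] * q" "poly q x0 \<noteq> 0"
    using order_decomp[of quartic x0] order_quartic[OF x0] by (auto simp: poly_eq_0_iff_dvd)
  define F where "F = fps_const x0 + fps_X ^ 2"
  obtain a where a: "poly_fls q (fps_to_fls F) = fps_to_fls a" "fps_nth a 0 = poly q (fps_nth F 0)"
    using poly_fls_fps by blast
  obtain s where s: "s ^ 2 = a" "fps_nth s 0 = csqrt (poly q x0)"
    using fps_sqrt_exists[of a "csqrt (poly q x0)"] a(2) q by (auto simp: F_def)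
  define X Y where "X = fps_to_fls F" and "Y = fls_X * fps_to_fls s"
  have X: "X = fls_const x0 + fls_X ^ 2" by (simp add: X_def F_def fps_to_fls_power)
  interpret series_point X Y
  proof
    have "poly_fls quartic X = fls_X ^ 2 * poly_fls q X"
      unfolding q(1) poly_fls_mult by (simp add: X)
    then show "Y ^ 2 = poly_fls quartic X"
      by (simp add: Y_def X_def a power_mult_distrib flip: fps_to_fls_power s(1))
    have "fls_nth X 2 = 1" by (simp add: X fls_X_power_nth)
    then show "X \<noteq> fls_const c" for c by auto
  qed
  have x: "embed X Y (CF [:- x0, 1:] 0) = fls_X ^ 2" by (simp add: X)
  have y: "embed X Y y_fun = fls_X * fps_to_fls s" by (simp add: Y_def)
  have "s \<noteq> 0" "subdegree s = 0" using s(2) q(2) by (auto simp: subdegree_eq_0_iff)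
  then have sub: "fls_subdegree (embed X Y y_fun) = 1"
    unfolding y by (simp add: fls_subdegree_fls_to_fps)
  have "embed X Y 1 = 1" by (simp add: one_curve_fun_def)
  then have v: "curve_valuation (\<lambda>h. fls_subdegree (embed X Y h))"
    using curve_valuation[of y_fun 1] sub by simp
  then show ?thesis
    using sub x by (intro exI[of _ "\<lambda>h. fls_subdegree (embed X Y h)"] conjI v)
      (simp add: curve_valuation.centred_def[OF v] curve_valuation.ge_def[OF v] del: embed_CF)
qed


text \<open>The local parameter at infinity is \<open>1/m\<close>, where \<open>m + 1/m = x\<close>: then also the
  eigenvalues of the peripheral elements become Laurent series.\<close>

definition X_inf :: "complex fls" where
  "X_inf = fls_X_inv + fls_X"

lemma fls_X_inv_mult_X: "fls_X_inv * fls_X = (1 :: complex fls)"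
  by (simp add: fls_X_inv_times_conv_shift)

lemma infinite_point_exists:
  obtains Y where "series_point X_inf Y"
proof -
  \<comment> \<open>For x = 1/t + t one has x^2 - 3 = t^-2 (1 - t^2 + t^4), so a is t^4 ((x^2 - 3)^2
    - 4).\<close>
  define a where "a = (1 - fps_X ^ 2 + fps_X ^ 4) ^ 2 - (4 * fps_X ^ 4 :: complex fps)"
  have "fps_nth a 0 = 1" by (simp add: a_def power2_eq_square)
  then obtain s where s: "s ^ 2 = a" "fps_nth s 0 = 1"
    using fps_sqrt_exists[of a 1] by auto
  define Y where "Y = fls_X_inv ^ 2 * fps_to_fls s"
  define t u where "t = (fls_X :: complex fls)" and "u = (fls_X_inv :: complex fls)"
  have tu: "u * t = 1" by (simp add: t_def u_def fls_X_inv_mult_X)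
  have a': "fps_to_fls a = (1 - t ^ 2 + t ^ 4) ^ 2 - 4 * t ^ 4"
    by (simp add: a_def t_def fps_to_fls_power fls_times_fps_to_fls)
  have "Y ^ 2 = u ^ 4 * fps_to_fls a"
    by (simp add: Y_def u_def power_mult_distrib flip: fps_to_fls_power s(1))
  also have "\<dots> = (u + t) ^ 4 - 6 * (u + t) ^ 2 + 5"
    unfolding a' using tu by algebra
  also have "\<dots> = poly_fls quartic X_inf"
    by (simp add: quartic_def X_inf_def t_def u_def algebra_simps power2_eq_square power4_eq_xxxx)
  finally have "Y ^ 2 = poly_fls quartic X_inf" .
  moreover have "fls_nth X_inf 1 = 1" by (simp add: X_inf_def)
  then have "X_inf \<noteq> fls_const c" for c by (metis fls_const_nth zero_neq_one)
  ultimately show ?thesis using that[of Y] by (simp add: series_point_def)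
qed

lemma infinite_valuation:
  assumes "series_point X_inf Y"
  shows "curve_valuation (\<lambda>h. fls_subdegree (embed X_inf Y h))"
    and "fls_subdegree (embed X_inf Y x_fun) = - 1"
proof -
  interpret series_point X_inf Y by fact
  have "fls_subdegree (fls_X_inv + fls_X :: complex fls) = - 1"
    by (subst fls_subdegree_add_eq1) auto
  then show x: "fls_subdegree (embed X_inf Y x_fun) = - 1"
    by (simp add: X_inf_def)
  have "embed X_inf Y 1 = 1" by (simp add: one_curve_fun_def)
  then show "curve_valuation (\<lambda>h. fls_subdegree (embed X_inf Y h))"
    using curve_valuation[of 1 x_fun] x by simp
qed

section \<open>Enumeration of the places and the balance of zeros and poles\<close>

definition places :: "(curve_fun \<Rightarrow> int) set" where
  "places = {v. curve_valuation v}"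

definition places_over :: "complex \<Rightarrow> (curve_fun \<Rightarrow> int) set" where
  "places_over x0 = {v \<in> places. 0 < v (CF [:- x0, 1:] 0)}"

definition infinite_places :: "(curve_fun \<Rightarrow> int) set" where
  "infinite_places = {v \<in> places. v x_fun < 0}"

lemma centred_conj:
  assumes v: "curve_valuation v" and c: "curve_valuation.centred v x0 y0"
  shows "curve_valuation.centred (\<lambda>h. v (conj_fun h)) x0 (- y0)"
proof -
  interpret curve_valuation v by fact
  interpret c: curve_valuation "\<lambda>h. v (conj_fun h)" by (rule conj)
  have "conj_fun (CF [:y0:] 1) = - CF [:- y0:] 1" by simp
  then have "v (conj_fun (CF [:y0:] 1)) = v (CF [:- y0:] 1)" by (simp only: v_uminus)
  then show ?thesis using c
    by (simp add: centred_def c.centred_def ge_def c.ge_def)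
qed

lemma unramified_unique:
  assumes y0: "y0 \<noteq> 0"
    and v: "curve_valuation v" "curve_valuation.centred v x0 y0"
  shows "v (CF [:- x0, 1:] 0) = 1"
    and "curve_valuation w \<Longrightarrow> curve_valuation.centred w x0 y0 \<Longrightarrow> v = w"
proof -
  let ?P = "\<lambda>v. curve_valuation v \<and> curve_valuation.centred v x0 y0"
  let ?e = "\<lambda>v. v (CF [:- x0, 1:] 0)"
  have val: "curve_valuation v \<and> 0 < ?e v" if "?P v" for v
    using that by (auto simp: curve_valuation.centred_def)
  note place_unique[of ?P ?e, OF unramified_formula[OF y0] val]
  then show "v (CF [:- x0, 1:] 0) = 1"
    and "curve_valuation w \<Longrightarrow> curve_valuation.centred w x0 y0 \<Longrightarrow> v = w"
    using v by blast+
qed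

lemma ramified_unique:
  assumes x0: "poly quartic x0 = 0"
    and v: "curve_valuation v" "curve_valuation.centred v x0 0"
  shows "v y_fun = 1"
    and "curve_valuation w \<Longrightarrow> curve_valuation.centred w x0 0 \<Longrightarrow> v = w"
proof -
  let ?P = "\<lambda>v. curve_valuation v \<and> curve_valuation.centred v x0 0"
  let ?e = "\<lambda>v. v y_fun"
  have val: "curve_valuation v \<and> 0 < ?e v" if "?P v" for v
    using that curve_valuation.ramified_uniformizer(2)[OF _ x0] by blast
  note place_unique[of ?P ?e, OF ramified_formula[OF x0] val]
  then show "v y_fun = 1"
    and "curve_valuation w \<Longrightarrow> curve_valuation.centred w x0 0 \<Longrightarrow> v = w"
    using v by blast+
qed

lemma infinite_unique:
  assumes s: "s = 1 \<or> s = -1"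
    and v: "curve_valuation v" "at_infinity s v"
  shows "v x_fun = -1"
    and "curve_valuation w \<Longrightarrow> at_infinity s w \<Longrightarrow> v = w"
proof -
  let ?P = "\<lambda>v. curve_valuation v \<and> at_infinity s v"
  let ?e = "\<lambda>v. - v x_fun"
  have val: "curve_valuation v \<and> 0 < ?e v" if "?P v" for v
    using that by (auto simp: at_infinity_def)
  note place_unique[of ?P ?e, OF infinite_formula[OF s] val]
  then show "v x_fun = -1"
    and "curve_valuation w \<Longrightarrow> at_infinity s w \<Longrightarrow> v = w"
    using v by (fastforce, blast)
qed

text \<open>Off the branch points there are two places, exchanged by conjugation, where x - x0 has
  value 1. At a branch point there is one, fixed by conjugation, where it has value 2. Either way
  the sum is read off from \<open>v_norm\<close>.\<close>

lemma sum_places_over: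
  assumes h: "h \<noteq> 0"
  shows "finite (places_over x0)" and "(\<Sum>v\<in>places_over x0. v h) = int (order x0 (curve_norm h))"
proof -
  define y0 where "y0 = csqrt (poly quartic x0)"
  have y0: "y0 ^ 2 = poly quartic x0" by (simp add: y0_def)
  have centre: "curve_valuation.centred v x0 y0 \<or> curve_valuation.centred v x0 (- y0)"
    if "v \<in> places_over x0" for v
    using that curve_valuation.centre_y[OF _ _ y0] by (auto simp: places_over_def places_def)
  have over: "v \<in> places_over x0" if "curve_valuation v" "curve_valuation.centred v x0 y" for v y
    using that curve_valuation.centred_def by (auto simp: places_over_def places_def)
  have "finite (places_over x0) \<and> (\<Sum>v\<in>places_over x0. v h) = int (order x0 (curve_norm h))"
  proof (cases "y0 = 0")
    case False
    obtain v where v: "curve_valuation v" "curve_valuation.centred v x0 y0"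
      using unramified_exists[OF y0 False] by blast
    interpret curve_valuation v by fact
    define w where "w = (\<lambda>h. v (conj_fun h))"
    have w: "curve_valuation w" "curve_valuation.centred w x0 (- y0)"
      unfolding w_def by (rule conj, rule centred_conj[OF v])
    have one: "v (CF [:- x0, 1:] 0) = 1" by (rule unramified_unique(1)[OF False v])
    have "places_over x0 = {v, w}"
    proof (intro equalityI subsetI)
      fix u assume u: "u \<in> places_over x0"
      then have "curve_valuation u" by (simp add: places_over_def places_def)
      then show "u \<in> {v, w}"
        using centre[OF u] unramified_unique(2)[OF False v, of u]
          unramified_unique(2)[OF _ w, of u] False by auto
    qed (use over v w in auto)
    moreover have "v \<noteq> w"
    proof
      assume "v = w"
      then have "centred x0 (- y0)" using w(2) by simp
      with v(2) have "ge 1 (CF [:y0:] 1)" "ge 1 (CF [:- y0:] 1)" by (auto simp: centred_def)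
      then have "ge 1 (CF [:y0:] 1 - CF [:- y0:] 1)" by (rule ge_diff)
      then show False using v_const[of "2 * y0"] False by (auto simp: ge_def)
    qed
    moreover have "v h + w h = int (order x0 (curve_norm h))"
      unfolding w_def v_norm[OF h] using v_poly[of x0 "curve_norm h"] one h by simp
    ultimately show ?thesis by simp
  next
    case True
    then have x0: "poly quartic x0 = 0" using y0 by simp
    obtain v where v: "curve_valuation v" "curve_valuation.centred v x0 0"
      using ramified_exists[OF x0] by blast
    interpret curve_valuation v by fact
    have one: "v (CF [:- x0, 1:] 0) = 2"
      using ramified_uniformizer(1)[OF x0 v(2)] ramified_unique(1)[OF x0 v] by simp
    have "(\<lambda>h. v (conj_fun h)) = v"
      using ramified_unique(2)[OF x0 v conj] centred_conj[OF v] by simp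
    then have "v (conj_fun h) = v h" by metis
    then have "v h = int (order x0 (curve_norm h))"
      using v_norm[OF h] v_poly[of x0 "curve_norm h"] one h by simp
    moreover have "places_over x0 = {v}"
    proof (intro equalityI subsetI)
      fix u assume u: "u \<in> places_over x0"
      then have "curve_valuation u" by (simp add: places_over_def places_def)
      then show "u \<in> {v}"
        using centre[OF u] ramified_unique(2)[OF x0 v, of u] True by auto
    qed (use over v in auto)
    ultimately show ?thesis by simp
  qed
  then show "finite (places_over x0)" "(\<Sum>v\<in>places_over x0. v h) = int (order x0 (curve_norm h))"
    by auto
qed

text \<open>Conjugation exchanges the two branches at infinity. A place on both of them would make
  the difference 2 s x^2 of two bounded functions bounded.\<close>

lemma infinite_places_eq:
  assumes v: "v \<in> infinite_places"
  shows "infinite_places = {v, \<lambda>h. v (conj_fun h)}" and "v \<noteq> (\<lambda>h. v (conj_fun h))"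
    and "v x_fun = -1"
proof -
  have cv: "curve_valuation v" and x: "v x_fun < 0"
    using v by (auto simp: infinite_places_def places_def)
  interpret curve_valuation v by fact
  interpret c: curve_valuation "\<lambda>h. v (conj_fun h)" by (rule conj)
  obtain s where s: "s = 1 \<or> s = -1" "at_infinity s v"
    using infinite_centre[OF x] by blast
  define w where "w = (\<lambda>h. v (conj_fun h))"
  have w: "curve_valuation w" unfolding w_def by (rule conj)
  have "conj_fun (CF [:0, 0, s:] 1) = - CF [:0, 0, - s:] 1" by simp
  then have "v (conj_fun (CF [:0, 0, s:] 1)) = v (CF [:0, 0, - s:] 1)" by (simp only: v_uminus)
  then have sw: "at_infinity (- s) w"
    using s(2) x by (simp add: at_infinity_def ge_def c.ge_def w_def)
  show "v x_fun = -1" by (rule infinite_unique(1)[OF s(1) cv s(2)])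
  show "v \<noteq> (\<lambda>h. v (conj_fun h))"
  proof
    assume "v = (\<lambda>h. v (conj_fun h))"
    then have "at_infinity (- s) v" using sw by (simp add: w_def)
    then have "ge 0 (CF [:0, 0, s:] 1)" "ge 0 (CF [:0, 0, - s:] 1)"
      using s(2) by (auto simp: at_infinity_def)
    then have "ge 0 (CF [:0, 0, s:] 1 - CF [:0, 0, - s:] 1)" by (rule ge_diff)
    then show False using v_poly_infinite[OF x, of "[:0, 0, 2 * s:]"] s(1) x by (auto simp: ge_def)
  qed
  have "infinite_places = {v, w}"
  proof (intro equalityI subsetI)
    fix u assume u: "u \<in> infinite_places"
    then have cu: "curve_valuation u" "u x_fun < 0" by (auto simp: infinite_places_def places_def)
    then have "at_infinity s u \<or> at_infinity (- s) u"
      using curve_valuation.infinite_centre[of u] s(1) by auto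
    then show "u \<in> {v, w}"
      using infinite_unique(2)[OF s(1) cv s(2) cu(1)] infinite_unique(2)[OF _ w sw cu(1)] s(1) by auto
  qed (use v w x in \<open>auto simp: infinite_places_def places_def w_def\<close>)
  then show "infinite_places = {v, \<lambda>h. v (conj_fun h)}" by (simp add: w_def)
qed

lemma infinite_places_nonempty: "infinite_places \<noteq> {}"
proof -
  obtain Y where Y: "series_point X_inf Y" by (rule infinite_point_exists)
  have "(\<lambda>h. fls_subdegree (embed X_inf Y h)) \<in> infinite_places"
    using infinite_valuation[OF Y] by (simp add: infinite_places_def places_def del: embed_CF)
  then show ?thesis by blast
qed

lemma sum_infinite_places:
  assumes h: "h \<noteq> 0"
  shows "finite infinite_places" and "(\<Sum>v\<in>infinite_places. v h) = - int (degree (curve_norm h))"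
proof -
  obtain v where v: "v \<in> infinite_places" using infinite_places_nonempty by blast
  then interpret curve_valuation v by (simp add: infinite_places_def places_def)
  note e = infinite_places_eq[OF v]
  show "finite infinite_places" by (subst e(1)) simp
  have "(\<Sum>v\<in>infinite_places. v h) = v h + v (conj_fun h)"
    by (subst e(1)) (use e(2) in simp)
  then show "(\<Sum>v\<in>infinite_places. v h) = - int (degree (curve_norm h))"
    using v_norm[OF h] v_poly_infinite[of "curve_norm h"] h e(3) by simp
qed

lemma sum_orders:
  fixes p :: "complex poly"
  assumes "p \<noteq> 0"
  shows "(\<Sum>r | poly p r = 0. order r p) = degree p"
proof -
  have "(\<Sum>r\<in>set_mset (proots p). count (proots p) r) = size (proots p)"
    by (simp add: size_multiset_overloaded_eq)
  then show ?thesis using assms by (simp add: size_proots_complex)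
qed

text \<open>Over a finite x0 the values add up to the order of the norm at x0, at infinity to minus
  its degree, and a complex polynomial has as many roots as its degree.\<close>

theorem sum_places:
  assumes h: "h \<noteq> 0"
  shows "finite {v \<in> places. v h \<noteq> 0}" and "(\<Sum>v | v \<in> places \<and> v h \<noteq> 0. v h) = 0"
proof -
  define R where "R = {r. poly (curve_norm h) r = 0}"
  define T where "T = infinite_places \<union> (\<Union>r\<in>R. places_over r)"
  have finR: "finite R" using h by (simp add: R_def poly_roots_finite)
  have finT: "finite T"
    using finR sum_places_over(1)[OF h] sum_infinite_places(1)[OF h] by (simp add: T_def)
  have sub: "{v \<in> places. v h \<noteq> 0} \<subseteq> T"
  proof
    fix v assume v: "v \<in> {v \<in> places. v h \<noteq> 0}"
    then interpret curve_valuation v by (simp add: places_def)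
    show "v \<in> T"
    proof (cases "v x_fun < 0")
      case True
      then show ?thesis using v by (simp add: T_def infinite_places_def)
    next
      case False
      then have x: "ge 0 x_fun" by (simp add: ge_def)
      obtain r where r: "0 < v (CF [:- r, 1:] 0)" using finite_centre[OF x] by blast
      \<comment> \<open>Both values are nonnegative and that of h is nonzero, so the norm has
        nonzero value and the centre is one of its roots.\<close>
      have "ge 0 h" "ge 0 (conj_fun h)" by (rule ge_regular[OF x])+
      then have "v (CF (curve_norm h) 0) \<noteq> 0"
        using v_norm[OF h] v h by (auto simp: ge_def)
      then have "r \<in> R" using v_poly_unit[OF r, of "curve_norm h"] by (auto simp: R_def)
      then show ?thesis using r v by (auto simp: T_def places_over_def)
    qed
  qed
  show "finite {v \<in> places. v h \<noteq> 0}" using sub finT by (rule finite_subset)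
  have disj1: "infinite_places \<inter> (\<Union>r\<in>R. places_over r) = {}"
    using curve_valuation.centre_x curve_valuation.ge_def
    by (fastforce simp: infinite_places_def places_over_def places_def)
  have disj2: "places_over r \<inter> places_over r' = {}" if "r \<noteq> r'" for r r'
    using that curve_valuation.v_poly_unit[of _ r "[:- r', 1:]"]
    by (fastforce simp: places_over_def places_def)
  have "(\<Sum>v | v \<in> places \<and> v h \<noteq> 0. v h) = (\<Sum>v\<in>T. v h)"
    using finT sub by (intro sum.mono_neutral_left) (auto simp: T_def places_over_def infinite_places_def)
  also have "\<dots> = (\<Sum>v\<in>infinite_places. v h) + (\<Sum>v\<in>(\<Union>r\<in>R. places_over r). v h)"
    unfolding T_def using disj1 finR sum_places_over(1)[OF h] sum_infinite_places(1)[OF h]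
    by (intro sum.union_disjoint) auto
  also have "(\<Sum>v\<in>(\<Union>r\<in>R. places_over r). v h) = (\<Sum>r\<in>R. \<Sum>v\<in>places_over r. v h)"
    using finR sum_places_over(1)[OF h] disj2 by (intro sum.UNION_disjoint) auto
  also have "\<dots> = int (\<Sum>r\<in>R. order r (curve_norm h))"
    by (simp add: sum_places_over(2)[OF h])
  also have "\<dots> = int (degree (curve_norm h))"
    unfolding R_def using h by (simp add: sum_orders)
  finally show "(\<Sum>v | v \<in> places \<and> v h \<noteq> 0. v h) = 0"
    using sum_infinite_places(2)[OF h] by simp
qed

lemma finite_place_ge: "v \<in> places \<Longrightarrow> v \<notin> infinite_places \<Longrightarrow> 0 \<le> v h"
  using curve_valuation.ge_regular[of v h] curve_valuation.ge_def[of v] curve_valuation.v_zero[of v]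
  by (fastforce simp: places_def infinite_places_def)

lemma sum_poles:
  "(\<Sum>v | v \<in> places \<and> v f < 0. - v f) = (\<Sum>v\<in>infinite_places. max 0 (- v f))"
proof -
  have "(\<Sum>v | v \<in> places \<and> v f < 0. - v f) = (\<Sum>v | v \<in> places \<and> v f < 0. max 0 (- v f))"
    by (rule sum.cong) auto
  also have "\<dots> = (\<Sum>v\<in>infinite_places. max 0 (- v f))"
    using finite_place_ge[of _ f] sum_infinite_places(1)[of 1]
    by (intro sum.mono_neutral_left) (fastforce simp: infinite_places_def)+
  finally show ?thesis .
qed

text \<open>Subtracting a constant changes neither the poles nor their orders, so the balance for f
  - c counts its zeros by the poles of f.\<close>

lemma sum_zeros:
  assumes f: "f \<noteq> const_fun c"
  shows "(\<Sum>v | v \<in> places \<and> 0 < v (f - const_fun c). v (f - const_fun c)) =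
    (\<Sum>v\<in>infinite_places. max 0 (- v f))"
proof -
  define g where "g = f - const_fun c"
  have g: "g \<noteq> 0" using f by (simp add: g_def)
  have neg: "v g < 0 \<and> v f = v g \<or> \<not> v g < 0 \<and> \<not> v f < 0" if "v \<in> places" for v
  proof -
    interpret curve_valuation v using that by (simp add: places_def)
    show ?thesis
    proof (cases "v g < 0")
      case True
      then have "ge (v g + 1) (const_fun c)" using ge_mono[OF ge_const] by simp
      then have "v (g + const_fun c) = v g" using v_add_eq[OF g] by blast
      then show ?thesis using True by (simp add: g_def)
    next
      case False
      then have "ge 0 (g + const_fun c)" using ge_add[OF _ ge_const] by (simp add: ge_def)
      then have "ge 0 f" by (simp add: g_def)
      \<comment> \<open>For f = 0 the bound on the value is the convention that v 0 = 0.\<close>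
      then show ?thesis using False v_zero by (auto simp: ge_def)
    qed
  qed
  let ?S = "{v. v \<in> places \<and> v g \<noteq> 0}"
  have fin: "finite {v. v \<in> places \<and> 0 < v g}" "finite {v. v \<in> places \<and> v g < 0}"
    using sum_places(1)[OF g] by (auto elim: finite_subset[rotated])
  have "?S = {v. v \<in> places \<and> 0 < v g} \<union> {v. v \<in> places \<and> v g < 0}" by auto
  then have "0 = (\<Sum>v | v \<in> places \<and> 0 < v g. v g) + (\<Sum>v | v \<in> places \<and> v g < 0. v g)"
    using sum_places(2)[OF g] fin by (subst sum.union_disjoint[symmetric]) auto
  then have "(\<Sum>v | v \<in> places \<and> 0 < v g. v g) = (\<Sum>v | v \<in> places \<and> v g < 0. - v g)"
    by (simp add: sum_negf)
  also have "\<dots> = (\<Sum>v | v \<in> places \<and> v f < 0. - v f)"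
  proof (rule sum.cong)
    have "v g < 0 \<longleftrightarrow> v f < 0" if "v \<in> places" for v using neg[OF that] by auto
    then show "{v. v \<in> places \<and> v g < 0} = {v. v \<in> places \<and> v f < 0}" by blast
    show "- v g = - v f" if "v \<in> {v. v \<in> places \<and> v f < 0}" for v using neg[of v] that by auto
  qed
  finally show ?thesis unfolding sum_poles g_def .
qed

section \<open>Words and representations\<close>

definition inv_word :: "word \<Rightarrow> word" where
  "inv_word w = rev (map (\<lambda>(g, s). (g, \<not> s)) w)"

lemma inv_word_simps [simp]:
  "inv_word [] = []"
  "inv_word ((g, s) # w) = inv_word w @ [(g, \<not> s)]"
  "inv_word (inv_word w) = w"
  by (simp_all add: inv_word_def rev_map comp_def case_prod_beta)

lemma weq_inv_word: "weq (w @ inv_word w) []"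
proof (induction w)
  case Nil
  then show ?case by (simp add: weq.refl)
next
  case (Cons l w)
  obtain g s where l: "l = (g, s)" by (cases l)
  have "weq (([(g, s)] @ (w @ inv_word w)) @ [(g, \<not> s)]) (([(g, s)] @ []) @ [(g, \<not> s)])"
    by (rule weq.append[OF weq.append[OF weq.refl Cons.IH] weq.refl])
  then show ?case
    using weq.trans[OF _ weq.cancel] by (simp add: l)
qed

lemma weq_inv_word': "weq (inv_word w @ w) []"
  using weq_inv_word[of "inv_word w"] by simp

lemma word_class_eq_iff: "word_class u = word_class v \<longleftrightarrow> weq u v"
  unfolding word_class_def by (blast intro: weq.refl weq.sym weq.trans)

lemma carrier_fig8: "carrier fig8_group = range word_class"
  by (simp add: fig8_group_def)

lemma word_class_in_carrier [simp]: "word_class w \<in> carrier fig8_group"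
  by (simp add: carrier_fig8)

lemma one_fig8: "\<one>\<^bsub>fig8_group\<^esub> = word_class []"
  by (simp add: fig8_group_def)

lemma mult_word_class: "word_class u \<otimes>\<^bsub>fig8_group\<^esub> word_class v = word_class (u @ v)"
proof -
  have "(\<exists>u'\<in>word_class u. \<exists>v'\<in>word_class v. weq (u' @ v') w) \<longleftrightarrow> weq (u @ v) w" for w
    unfolding word_class_def by (auto intro: weq.refl weq.append weq.trans)
  then show ?thesis by (auto simp: fig8_group_def word_class_def)
qed

lemma group_fig8: "group fig8_group"
proof (rule groupI)
  fix U assume "U \<in> carrier fig8_group"
  then obtain u where "U = word_class u" by (auto simp: carrier_fig8)
  then show "\<exists>V\<in>carrier fig8_group. V \<otimes>\<^bsub>fig8_group\<^esub> U = \<one>\<^bsub>fig8_group\<^esub>"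
    by (intro bexI[of _ "word_class (inv_word u)"])
      (simp_all add: mult_word_class one_fig8 word_class_eq_iff weq_inv_word')
qed (auto simp: carrier_fig8 mult_word_class one_fig8)

lemma inv_word_class: "inv\<^bsub>fig8_group\<^esub> (word_class w) = word_class (inv_word w)"
  by (rule group.inv_equality[OF group_fig8])
    (simp_all add: mult_word_class one_fig8 word_class_eq_iff weq_inv_word')

section \<open>Matrices of words and representations of the group\<close>

lemma mat2_eq_iff:
  "M = N \<longleftrightarrow> M$1$1 = N$1$1 \<and> M$1$2 = N$1$2 \<and> M$2$1 = N$2$1 \<and> M$2$2 = N$2$2"
  for M N :: "'a^2^2"
  by (auto simp: vec_eq_iff forall_2)

lemma mat2_mult: "(M ** N)$i$j = M$i$1 * N$1$j + M$i$2 * N$2$j"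
  for M N :: "'a::semiring_1^2^2"
  by (simp add: matrix_matrix_mult_def sum_2)

lemma mat2_trace: "trace M = M$1$1 + M$2$2" for M :: "'a::comm_semiring_1^2^2"
  by (simp add: trace_def sum_2)

lemma mat2_one: "(mat 1 :: complex^2^2)$i$j = (if i = j then 1 else 0)"
  by (simp add: mat_def)

text \<open>The adjugate: the inverse of a matrix of determinant 1, in a form that is linear in the
  matrix.\<close>

definition adj2 :: "complex^2^2 \<Rightarrow> complex^2^2" where
  "adj2 M = (\<chi> i j. (if i = j then trace M else 0) - M$i$j)"

lemma adj2_entries:
  "(adj2 M)$1$1 = M$2$2" "(adj2 M)$1$2 = - M$1$2" "(adj2 M)$2$1 = - M$2$1" "(adj2 M)$2$2 = M$1$1"
  by (simp_all add: adj2_def mat2_trace)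

lemma adj2_mult:
  assumes "det M = 1"
  shows "M ** adj2 M = mat 1" "adj2 M ** M = mat 1"
  using assms by (auto simp: mat2_eq_iff mat2_mult adj2_entries mat2_one det_2 algebra_simps)

lemma det_adj2: "det (adj2 M) = det M"
  by (simp add: det_2 adj2_entries)

fun letter_mat :: "complex^2^2 \<Rightarrow> complex^2^2 \<Rightarrow> generator \<times> bool \<Rightarrow> complex^2^2" where
  "letter_mat A B (Alpha, True) = A"
| "letter_mat A B (Alpha, False) = adj2 A"
| "letter_mat A B (Beta, True) = B"
| "letter_mat A B (Beta, False) = adj2 B"

definition word_mat :: "complex^2^2 \<Rightarrow> complex^2^2 \<Rightarrow> word \<Rightarrow> complex^2^2" where
  "word_mat A B w = foldr (\<lambda>l M. letter_mat A B l ** M) w (mat 1)"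

lemma word_mat_Nil [simp]: "word_mat A B [] = mat 1"
  and word_mat_Cons [simp]: "word_mat A B (l # w) = letter_mat A B l ** word_mat A B w"
  by (simp_all add: word_mat_def)

lemma word_mat_append [simp]: "word_mat A B (u @ v) = word_mat A B u ** word_mat A B v"
  by (induction u) (simp_all add: matrix_mul_assoc)

lemma letter_mat_cancel:
  assumes "det A = 1" "det B = 1"
  shows "letter_mat A B (g, s) ** letter_mat A B (g, \<not> s) = mat 1"
  using adj2_mult assms by (cases g; cases s) auto

lemma det_word_mat:
  assumes "det A = 1" "det B = 1"
  shows "det (word_mat A B w) = 1"
proof (induction w)
  case (Cons l w)
  have "det (letter_mat A B l) = 1"
    using assms by (cases "(A, B, l)" rule: letter_mat.cases) (auto simp: det_adj2)
  then show ?case using Cons by (simp add: det_mul)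
qed simp

lemma word_mat_weq:
  assumes "det A = 1" "det B = 1" "word_mat A B relator = mat 1"
  shows "weq u v \<Longrightarrow> word_mat A B u = word_mat A B v"
proof (induction rule: weq.induct)
  case (cancel g s)
  then show ?case using letter_mat_cancel[OF assms(1,2)] by simp
qed (use assms in simp_all)

lemma word_mat_inv_word:
  assumes "det A = 1" "det B = 1"
  shows "word_mat A B w ** word_mat A B (inv_word w) = mat 1"
proof (induction w)
  case (Cons l w)
  obtain g s where l: "l = (g, s)" by (cases l)
  have "word_mat A B (l # w) ** word_mat A B (inv_word (l # w)) =
    letter_mat A B l ** (word_mat A B w ** word_mat A B (inv_word w)) ** letter_mat A B (g, \<not> s)"
    by (simp add: l matrix_mul_assoc)
  then show ?case using Cons letter_mat_cancel[OF assms] by (simp add: l)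
qed simp

definition representation :: "complex^2^2 \<Rightarrow> complex^2^2 \<Rightarrow> bool" where
  "representation A B \<longleftrightarrow> det A = 1 \<and> det B = 1 \<and> word_mat A B relator = mat 1"

lemma hom_word_mat:
  assumes \<rho>: "\<rho> \<in> hom fig8_group SL2C"
  defines "A \<equiv> \<rho> (word_class [(Alpha, True)])" and "B \<equiv> \<rho> (word_class [(Beta, True)])"
  shows "representation A B" and "\<rho> (word_class w) = word_mat A B w"
proof -
  have mult: "\<rho> (word_class (u @ v)) = \<rho> (word_class u) ** \<rho> (word_class v)" for u v
    using hom_mult[OF \<rho>, of "word_class u" "word_class v"] by (simp add: mult_word_class SL2C_def)
  have det: "det (\<rho> (word_class u)) = 1" for u
    using hom_in_carrier[OF \<rho>, of "word_class u"] by (simp add: SL2C_def)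
  have cancel: "M = adj2 N" if "N ** M = mat 1" "det N = 1" for M N
    using that adj2_mult(2)[of N] by (metis matrix_mul_assoc matrix_mul_lid matrix_mul_rid)
  \<comment> \<open>\<open>hom\<close> only asks for products to be preserved. The image of the
    identity is idempotent and invertible, hence the identity matrix.\<close>
  have "\<rho> (word_class []) ** \<rho> (word_class []) = \<rho> (word_class [])"
    using mult[of "[]" "[]"] by simp
  then have one: "\<rho> (word_class []) = mat 1"
    using adj2_mult(2)[OF det[of "[]"]] by (metis matrix_mul_assoc matrix_mul_lid)
  have AB: "det A = 1" "det B = 1" unfolding A_def B_def by (rule det)+
  have inv: "\<rho> (word_class [(g, False)]) = adj2 (\<rho> (word_class [(g, True)]))" for g
  proof (rule cancel)
    have "word_class ([(g, True)] @ [(g, False)]) = word_class []"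
      using weq.cancel[of g True] by (simp add: word_class_eq_iff)
    then show "\<rho> (word_class [(g, True)]) ** \<rho> (word_class [(g, False)]) = mat 1"
      using one mult by metis
  qed (rule det)
  have letter: "\<rho> (word_class [l]) = letter_mat A B l" for l
    by (cases "(A, B, l)" rule: letter_mat.cases) (auto simp: A_def B_def inv)
  show w: "\<rho> (word_class w) = word_mat A B w" for w
  proof (induction w)
    case (Cons l w)
    then show ?case using mult[of "[l]" w] letter by simp
  qed (simp add: one)
  have "word_class relator = word_class []"
    using weq.relator by (simp add: word_class_eq_iff)
  then have "word_mat A B relator = mat 1" using w[of relator] one by simp
  then show "representation A B" using AB by (simp add: representation_def)
qed

lemma character_variety_representation:
  assumes "\<phi> \<in> character_variety"
  obtains A B where "representation A B" "\<And>w. \<phi> (word_class w) = trace (word_mat A B w)"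
proof -
  obtain \<rho> where \<rho>: "\<rho> \<in> hom fig8_group SL2C" "\<phi> = character_of \<rho>"
    using assms by (auto simp: character_variety_def)
  have "\<phi> (word_class w) = trace (\<rho> (word_class w))" for w
    by (simp add: \<rho>(2) character_of_def)
  also note hom_word_mat(2)[OF \<rho>(1)]
  finally show ?thesis by (rule that[OF hom_word_mat(1)[OF \<rho>(1)]])
qed

lemma representation_character:
  assumes AB: "representation A B"
  obtains \<phi> where "\<phi> \<in> character_variety" "\<And>w. \<phi> (word_class w) = trace (word_mat A B w)"
proof -
  define \<rho> where "\<rho> U = word_mat A B (SOME u. u \<in> U)" for U
  have \<rho>: "\<rho> (word_class w) = word_mat A B w" for w
  proof -
    have "(SOME u. u \<in> word_class w) \<in> word_class w"
      by (rule someI[of _ w]) (simp add: word_class_def weq.refl)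
    then have "weq w (SOME u. u \<in> word_class w)" by (simp add: word_class_def)
    then show ?thesis
      using word_mat_weq AB by (simp add: \<rho>_def representation_def)
  qed
  have "\<rho> \<in> hom fig8_group SL2C"
    using AB by (intro homI) (auto simp: carrier_fig8 mult_word_class \<rho> SL2C_def representation_def det_word_mat)
  then have "character_of \<rho> \<in> character_variety" by (simp add: character_variety_def)
  then show ?thesis by (rule that) (simp add: character_of_def \<rho>)
qed


section \<open>Traces of words\<close>

text \<open>
  The algebra generated by two matrices of determinant 1 and equal trace \<open>x\<close> is spanned by
  \<open>1, A, B, A B\<close>. With \<open>z\<close> the trace of \<open>A B\<close>, a quadruple of coefficients is multiplied from the
  right by \<open>A\<close> and \<open>B\<close> through \<open>A\<^sup>2 = x A - 1\<close> and \<open>B A = - A B + x B + x A + (z - x\<^sup>2)\<close>, and by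
  their inverses through \<open>A\<^sup>-\<^sup>1 = x - A\<close>.
\<close>

type_synonym 'a quad = "'a \<times> 'a \<times> 'a \<times> 'a"

fun mult_gen :: "'a::comm_ring_1 \<Rightarrow> 'a \<Rightarrow> generator \<Rightarrow> 'a quad \<Rightarrow> 'a quad" where
  "mult_gen x z Alpha (c0, c1, c2, c3) =
    (- c1 + (z - x * x) * c2 - x * c3, c0 + x * c1 + x * c2 + z * c3, x * c2 + c3, - c2)"
| "mult_gen x z Beta (c0, c1, c2, c3) = (- c2, - c3, c0 + x * c2, c1 + x * c3)"

fun mult_letter :: "'a::comm_ring_1 \<Rightarrow> 'a \<Rightarrow> generator \<times> bool \<Rightarrow> 'a quad \<Rightarrow> 'a quad" where
  "mult_letter x z (g, True) c = mult_gen x z g c"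
| "mult_letter x z (g, False) (c0, c1, c2, c3) =
    (case mult_gen x z g (c0, c1, c2, c3) of
      (d0, d1, d2, d3) \<Rightarrow> (x * c0 - d0, x * c1 - d1, x * c2 - d2, x * c3 - d3))"

text \<open>The fold from the left matches multiplication by letters from the right. The ring is
  left open: over the complex numbers this computes in a single representation, over
  \<open>curve_fun\<close> it yields the trace as a regular function.\<close>

definition coeffs_word :: "'a::comm_ring_1 \<Rightarrow> 'a \<Rightarrow> word \<Rightarrow> 'a quad" where
  "coeffs_word x z w = fold (mult_letter x z) w (1, 0, 0, 0)"

fun trace_quad :: "'a::comm_ring_1 \<Rightarrow> 'a \<Rightarrow> 'a quad \<Rightarrow> 'a" where
  "trace_quad x z (c0, c1, c2, c3) = 2 * c0 + x * c1 + x * c2 + z * c3"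

fun lin_comb :: "complex^2^2 \<Rightarrow> complex^2^2 \<Rightarrow> complex quad \<Rightarrow> complex^2^2" where
  "lin_comb A B (c0, c1, c2, c3) =
    (\<chi> i j. c0 * (mat 1 :: complex^2^2)$i$j + c1 * A$i$j + c2 * B$i$j + c3 * (A ** B)$i$j)"

lemma trace_lin_comb:
  assumes "trace A = x" "trace B = x" "trace (A ** B) = z"
  shows "trace (lin_comb A B c) = trace_quad x z c"
proof (cases c)
  case (fields c0 c1 c2 c3)
  have "trace (lin_comb A B c) = 2 * c0 + c1 * trace A + c2 * trace B + c3 * trace (A ** B)"
    by (simp add: fields mat2_trace mat2_one algebra_simps)
  then show ?thesis by (simp add: fields assms mult.commute)
qed

lemma lin_comb_mult_gen:
  assumes "det A = 1" "det B = 1" "trace A = x" "trace B = x" "trace (A ** B) = z"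
  shows "lin_comb A B c ** A = lin_comb A B (mult_gen x z Alpha c)"
    and "lin_comb A B c ** B = lin_comb A B (mult_gen x z Beta c)"
proof -
  obtain c0 c1 c2 c3 where c: "c = (c0, c1, c2, c3)" by (cases c)
  define a b d e where "a = A$1$1" "b = A$1$2" "d = A$2$1" "e = A$2$2"
  define p q r s where "p = B$1$1" "q = B$1$2" "r = B$2$1" "s = B$2$2"
  note defs = a_b_d_e_def p_q_r_s_def
  \<comment> \<open>The traces express x, s and z through the other entries; the determinants remain
    as the only relations.\<close>
  have h: "a * e - b * d = 1" "p * s - q * r = 1" "x = a + e" "s = a + e - p"
    "z = a * p + b * r + (d * q + e * s)"
    using assms by (auto simp: defs det_2 mat2_trace mat2_mult algebra_simps)
  show "lin_comb A B c ** A = lin_comb A B (mult_gen x z Alpha c)"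
    unfolding mat2_eq_iff
    apply (simp add: c mat2_mult mat2_one flip: defs)
    apply (intro conjI; use h in algebra)
    done
  show "lin_comb A B c ** B = lin_comb A B (mult_gen x z Beta c)"
    unfolding mat2_eq_iff
    apply (simp add: c mat2_mult mat2_one flip: defs)
    apply (intro conjI; use h in algebra)
    done
qed

lemma mult_adj2: "(M ** adj2 N)$i$j = trace N * M$i$j - (M ** N)$i$j" for i j :: 2
  using exhaust_2[of i] exhaust_2[of j]
  by (auto simp: mat2_mult adj2_entries mat2_trace algebra_simps)

lemma coeffs_word_Nil [simp]: "coeffs_word x z [] = (1, 0, 0, 0)"
  and coeffs_word_snoc [simp]: "coeffs_word x z (w @ [l]) = mult_letter x z l (coeffs_word x z w)"
  by (simp_all add: coeffs_word_def)

lemma lin_comb_mult_letter: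
  assumes "det A = 1" "det B = 1" "trace A = x" "trace B = x" "trace (A ** B) = z"
  shows "lin_comb A B c ** letter_mat A B l = lin_comb A B (mult_letter x z l c)"
proof -
  obtain g s where l: "l = (g, s)" by (cases l)
  obtain c0 c1 c2 c3 where c: "c = (c0, c1, c2, c3)" by (cases c)
  obtain d0 d1 d2 d3 where d: "mult_gen x z g (c0, c1, c2, c3) = (d0, d1, d2, d3)" by (cases "mult_gen x z g (c0, c1, c2, c3)")
  have gen: "lin_comb A B c ** letter_mat A B (g, True) = lin_comb A B (mult_gen x z g c)"
    using lin_comb_mult_gen[OF assms] by (cases g) simp_all
  show ?thesis
  proof (cases s)
    case True
    then show ?thesis using gen by (simp add: l)
  next
    case False
    have "letter_mat A B (g, False) = adj2 (letter_mat A B (g, True))"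
      by (cases g) simp_all
    moreover have "trace (letter_mat A B (g, True)) = x" using assms by (cases g) simp_all
    ultimately have "(lin_comb A B c ** letter_mat A B (g, False))$i$j =
      x * lin_comb A B c$i$j - lin_comb A B (mult_gen x z g c)$i$j" for i j
      using mult_adj2[of "lin_comb A B c" "letter_mat A B (g, True)" i j] gen by simp
    then show ?thesis
      using False by (simp add: l mat2_eq_iff c d algebra_simps)
  qed
qed

lemma word_mat_lin_comb:
  assumes "det A = 1" "det B = 1" "trace A = x" "trace B = x" "trace (A ** B) = z"
  shows "word_mat A B w = lin_comb A B (coeffs_word x z w)"
proof (induction w rule: rev_induct)
  case Nil
  show ?case by (simp add: mat2_eq_iff)
next
  case (snoc l w)
  have "word_mat A B (w @ [l]) = lin_comb A B (coeffs_word x z w) ** letter_mat A B l"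
    using snoc by simp
  then show ?case using lin_comb_mult_letter[OF assms] by simp
qed

lemma trace_word_mat:
  assumes "det A = 1" "det B = 1" "trace A = x" "trace B = x" "trace (A ** B) = z"
  shows "trace (word_mat A B w) = trace_quad x z (coeffs_word x z w)"
  using word_mat_lin_comb[OF assms] trace_lin_comb[OF assms(3-5)] by simp

text \<open>The relator of the group is \<open>\<beta>\<^sup>-\<^sup>1 w \<alpha> w\<^sup>-\<^sup>1\<close> for the following word \<open>w\<close>.\<close>

definition conj_word :: word where
  "conj_word = [(Alpha, False), (Beta, True), (Alpha, True), (Beta, False)]"

lemma relator_conj_word: "relator = (Beta, False) # conj_word @ [(Alpha, True)] @ inv_word conj_word"
  by (simp add: relator_def conj_word_def)

definition riley_poly :: "'a::comm_ring_1 \<Rightarrow> 'a \<Rightarrow> 'a" where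
  "riley_poly x z = z * z - (1 + x * x) * z + 2 * (x * x) - 1"

text \<open>The middle entries are the coefficients of A and B, so the two words differ by
  \<open>riley_poly\<close> times A - B.\<close>

lemma coeffs_word_relation:
  assumes "coeffs_word x z ([(Beta, True)] @ conj_word) = (c0, c1, c2, c3)"
  shows "coeffs_word x z (conj_word @ [(Alpha, True)]) =
    (c0, c1 + riley_poly x z, c2 - riley_poly x z, c3)"
  using assms[symmetric]
  by (simp add: coeffs_word_def conj_word_def riley_poly_def algebra_simps)

lemma relator_iff:
  assumes "det A = 1" "det B = 1"
  shows "word_mat A B relator = mat 1 \<longleftrightarrow>
    word_mat A B (conj_word @ [(Alpha, True)]) = word_mat A B ([(Beta, True)] @ conj_word)"
proof -
  define W W' where "W = word_mat A B conj_word" and "W' = word_mat A B (inv_word conj_word)"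
  have W: "W ** W' = mat 1" "W' ** W = mat 1"
    using word_mat_inv_word[OF assms, of conj_word] word_mat_inv_word[OF assms, of "inv_word conj_word"]
    by (simp_all add: W_def W'_def)
  have "word_mat A B relator = adj2 B ** W ** A ** W'"
    unfolding relator_conj_word by (simp add: W_def W'_def matrix_mul_assoc)
  moreover have "adj2 B ** W ** A ** W' = mat 1 \<longleftrightarrow> W ** A = B ** W"
  proof
    assume 1: "adj2 B ** W ** A ** W' = mat 1"
    have "W ** A = (B ** adj2 B) ** W ** A ** (W' ** W)"
      using W adj2_mult[OF assms(2)] by simp
    also have "\<dots> = B ** (adj2 B ** W ** A ** W') ** W" by (simp add: matrix_mul_assoc)
    finally show "W ** A = B ** W" unfolding 1 by simp
  next
    assume 2: "W ** A = B ** W"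
    have "adj2 B ** W ** A ** W' = adj2 B ** (W ** A) ** W'" by (simp add: matrix_mul_assoc)
    also have "\<dots> = (adj2 B ** B) ** (W ** W')" unfolding 2 by (simp add: matrix_mul_assoc)
    finally show "adj2 B ** W ** A ** W' = mat 1" using W adj2_mult[OF assms(2)] by simp
  qed
  ultimately show ?thesis by (simp add: W_def)
qed

text \<open>The relator makes \<beta> a conjugate of \<alpha>, so every representation meets the
  equal trace hypothesis of \<open>trace_word_mat\<close>.\<close>

lemma representation_trace:
  assumes "representation A B"
  shows "trace B = trace A"
proof -
  have AB: "det A = 1" "det B = 1" "word_mat A B relator = mat 1"
    using assms by (auto simp: representation_def)
  define W W' where "W = word_mat A B conj_word" and "W' = word_mat A B (inv_word conj_word)"
  have W: "W ** W' = mat 1" "W' ** W = mat 1"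
    using word_mat_inv_word[OF AB(1,2), of conj_word] word_mat_inv_word[OF AB(1,2), of "inv_word conj_word"]
    by (simp_all add: W_def W'_def)
  have "W ** A = B ** W"
    using relator_iff[OF AB(1,2)] AB(3) by (simp add: W_def)
  then have "B = W ** (A ** W')" using W by (metis matrix_mul_assoc matrix_mul_rid)
  then have "trace B = trace ((A ** W') ** W)" by (metis trace_mul_sym)
  also have "\<dots> = trace A" using W by (metis matrix_mul_assoc matrix_mul_rid)
  finally show ?thesis .
qed

lemma relator_riley_poly:
  assumes AB: "det A = 1" "det B = 1" "trace A = x" "trace B = x" "trace (A ** B) = z"
  shows "word_mat A B relator = mat 1 \<longleftrightarrow> riley_poly x z = 0 \<or> A = B"
proof -
  obtain c0 c1 c2 c3 where c: "coeffs_word x z ([(Beta, True)] @ conj_word) = (c0, c1, c2, c3)"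
    by (cases "coeffs_word x z ([(Beta, True)] @ conj_word)")
  have "(word_mat A B (conj_word @ [(Alpha, True)]))$i$j - (word_mat A B ([(Beta, True)] @ conj_word))$i$j
      = riley_poly x z * (A$i$j - B$i$j)" for i j
    unfolding word_mat_lin_comb[OF AB] coeffs_word_relation[OF c] c by (simp add: algebra_simps)
  then have "word_mat A B (conj_word @ [(Alpha, True)]) = word_mat A B ([(Beta, True)] @ conj_word)
      \<longleftrightarrow> (\<forall>i j. riley_poly x z * (A$i$j - B$i$j) = 0)"
    unfolding vec_eq_iff by (metis eq_iff_diff_eq_0)
  also have "\<dots> \<longleftrightarrow> riley_poly x z = 0 \<or> A = B"
    by (auto simp: vec_eq_iff)
  finally show ?thesis unfolding relator_iff[OF AB(1,2)] .
qed

lemma representation_cases: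
  assumes "representation A B" "x = trace A" "z = trace (A ** B)"
  shows "riley_poly x z = 0 \<or> z = x * x - 2"
proof -
  have AB: "det A = 1" "det B = 1" "trace A = x" "trace B = x" "trace (A ** B) = z"
    using assms representation_trace[OF assms(1)] by (auto simp: representation_def)
  \<comment> \<open>For A = B, z is the trace of A^2 = x A - 1.\<close>
  have "z = x * x - 2" if "A = B"
  proof -
    have d: "A$1$1 * A$2$2 - A$1$2 * A$2$1 = 1" using AB(1) by (simp add: det_2)
    have z: "z = A$1$1 * A$1$1 + A$1$2 * A$2$1 + (A$2$1 * A$1$2 + A$2$2 * A$2$2)"
      and x: "x = A$1$1 + A$2$2"
      using that assms(2,3) by (simp_all add: mat2_trace mat2_mult)
    show ?thesis unfolding z x using d by algebra
  qed
  then show ?thesis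
    using relator_riley_poly[OF AB] assms(1) by (auto simp: representation_def)
qed

section \<open>Two commutators and Riley's matrices\<close>

definition comm_word1 :: word where
  "comm_word1 = [(Alpha, True), (Beta, True), (Alpha, False), (Beta, False)]"

definition comm_word2 :: word where
  "comm_word2 = [(Alpha, True), (Beta, False), (Alpha, False), (Beta, True)]"

text \<open>T is tr [A, B] - 2, which vanishes for reducible pairs. Their commutators are unipotent
  and triangular in a common basis, so they commute, in accordance with the factor T in the
  difference.\<close>

lemma coeffs_word_commutators:
  assumes "coeffs_word x z (comm_word2 @ comm_word1) = (c0, c1, c2, c3)"
  defines "T \<equiv> (z - 2) * (z - x * x + 2)"
  shows "coeffs_word x z (comm_word1 @ comm_word2) = (c0, c1 + x * z * T, c2, c3 - x * x * T)"
  using assms(1)[symmetric]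
  by (simp add: coeffs_word_def comm_word1_def comm_word2_def T_def algebra_simps)

text \<open>Riley's normal form: both matrices have the eigenvalues m and 1/m, and each fixes a
  coordinate axis. The parameter r shifts the trace of the product, so every z can be reached for a
  given x.\<close>

definition riley_A :: "complex \<Rightarrow> complex^2^2" where
  "riley_A m = (\<chi> i j. if i = 1 then (if j = 1 then m else 1) else (if j = 1 then 0 else 1 / m))"

definition riley_B :: "complex \<Rightarrow> complex \<Rightarrow> complex^2^2" where
  "riley_B m r = (\<chi> i j. if i = 1 then (if j = 1 then m else 0) else (if j = 1 then r else 1 / m))"

lemma riley_entries:
  "(riley_A m)$1$1 = m" "(riley_A m)$1$2 = 1" "(riley_A m)$2$1 = 0" "(riley_A m)$2$2 = 1 / m"
  "(riley_B m r)$1$1 = m" "(riley_B m r)$1$2 = 0" "(riley_B m r)$2$1 = r" "(riley_B m r)$2$2 = 1 / m"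
  by (simp_all add: riley_A_def riley_B_def)

lemma riley_traces:
  assumes "m \<noteq> 0"
  shows "det (riley_A m) = 1" "det (riley_B m r) = 1" "trace (riley_A m) = m + 1 / m"
    "trace (riley_B m r) = m + 1 / m" "trace (riley_A m ** riley_B m r) = m * m + 1 / (m * m) + r"
  using assms by (simp_all add: det_2 mat2_trace mat2_mult riley_entries)

lemma riley_representation:
  assumes "m \<noteq> 0" "riley_poly (m + 1 / m) (m * m + 1 / (m * m) + r) = 0"
  shows "representation (riley_A m) (riley_B m r)"
  using relator_riley_poly[OF riley_traces[OF assms(1)]] assms riley_traces[OF assms(1)]
  by (simp add: representation_def)

lemma representation_with_trace:
  assumes "riley_poly x z = 0"
  obtains A B where "representation A B" "trace A = x" "trace (A ** B) = z"
proof -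
  \<comment> \<open>An eigenvalue of a matrix with trace x and determinant 1.\<close>
  define m where "m = (x + csqrt (x ^ 2 - 4)) / 2"
  have "2 * m - x = csqrt (x ^ 2 - 4)" by (simp add: m_def field_simps)
  then have "(2 * m - x) ^ 2 = x ^ 2 - 4" by (metis power2_csqrt)
  then have m: "m * m + 1 = x * m" by algebra
  then have m0: "m \<noteq> 0" by auto
  then have x: "x = m + 1 / m" using m by (simp add: field_simps)
  define r where "r = z - (m * m + 1 / (m * m))"
  show ?thesis
    using that[OF riley_representation[OF m0, of r]] riley_traces[OF m0] assms
    by (simp add: r_def flip: x)
qed

text \<open>At x = 2 and z = 2 + r the equation of the curve becomes r^2 - r + 1 = 0, with the root
  r = exp(i pi / 3). There T = r^2, and in the lower left corner A has 0 and A B has r, so the two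
  products differ by -4 r^3.\<close>

lemma commutators_not_weq: "\<not> weq (comm_word1 @ comm_word2) (comm_word2 @ comm_word1)"
proof
  assume weq: "weq (comm_word1 @ comm_word2) (comm_word2 @ comm_word1)"
  define r where "r = Complex (1 / 2) (sqrt 3 / 2)"
  have r: "r * r = r - 1"
    by (simp add: r_def complex_eq_iff)
  have r0: "r \<noteq> 0" by (simp add: r_def complex_eq_iff)
  define A B where "A = riley_A 1" and "B = riley_B 1 r"
  have AB: "det A = 1" "det B = 1" "trace A = 2" "trace B = 2" "trace (A ** B) = 2 + r"
    using riley_traces[where m = 1] by (simp_all add: A_def B_def)
  have "representation A B"
    unfolding A_def B_def
    by (rule riley_representation) (use r in \<open>simp_all add: riley_poly_def algebra_simps\<close>)
  then have eq: "word_mat A B (comm_word1 @ comm_word2) = word_mat A B (comm_word2 @ comm_word1)"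
    using word_mat_weq[OF _ _ _ weq] by (simp only: representation_def)
  obtain c0 c1 c2 c3 where c: "coeffs_word 2 (2 + r) (comm_word2 @ comm_word1) = (c0, c1, c2, c3)"
    by (cases "coeffs_word 2 (2 + r) (comm_word2 @ comm_word1)")
  have "(word_mat A B (comm_word1 @ comm_word2))$2$1 = (word_mat A B (comm_word2 @ comm_word1))$2$1
      - 4 * (r * r) * r"
    unfolding word_mat_lin_comb[OF AB] coeffs_word_commutators[OF c] c
    by (simp add: A_def B_def mat2_mult riley_entries algebra_simps)
  then show False using eq r0 by simp
qed

lemma faithful_trace:
  assumes \<rho>: "\<rho> \<in> hom fig8_group SL2C" "inj_on \<rho> (carrier fig8_group)"
    and AB: "representation A B" "\<And>w. \<rho> (word_class w) = word_mat A B w"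
  shows "trace (A ** B) \<noteq> trace A * trace A - 2"
proof
  assume z: "trace (A ** B) = trace A * trace A - 2"
  define x where "x = trace A"
  have AB': "det A = 1" "det B = 1" "trace A = x" "trace B = x" "trace (A ** B) = x * x - 2"
    using AB(1) representation_trace[OF AB(1)] z by (auto simp: representation_def x_def)
  obtain c0 c1 c2 c3 where c: "coeffs_word x (x * x - 2) (comm_word2 @ comm_word1) = (c0, c1, c2, c3)"
    by (cases "coeffs_word x (x * x - 2) (comm_word2 @ comm_word1)")
  have "word_mat A B (comm_word1 @ comm_word2) = word_mat A B (comm_word2 @ comm_word1)"
    unfolding word_mat_lin_comb[OF AB'] coeffs_word_commutators[OF c] c by simp
  then have "\<rho> (word_class (comm_word1 @ comm_word2)) = \<rho> (word_class (comm_word2 @ comm_word1))"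
    by (simp only: AB(2))
  then have "word_class (comm_word1 @ comm_word2) = word_class (comm_word2 @ comm_word1)"
    using \<rho>(2) by (simp add: inj_on_eq_iff)
  then show False using commutators_not_weq by (simp add: word_class_eq_iff)
qed

section \<open>The canonical component\<close>

definition x_coord :: "character \<Rightarrow> complex" where
  "x_coord \<phi> = \<phi> (word_class [(Alpha, True)])"

definition z_coord :: "character \<Rightarrow> complex" where
  "z_coord \<phi> = \<phi> (word_class [(Alpha, True), (Beta, True)])"

definition y_coord :: "character \<Rightarrow> complex" where
  "y_coord \<phi> = 2 * z_coord \<phi> - 1 - x_coord \<phi> ^ 2"

definition fig8_curve :: "character set" where
  "fig8_curve = {\<phi> \<in> character_variety. riley_poly (x_coord \<phi>) (z_coord \<phi>) = 0}"

lemma z_from_y: "z_coord \<phi> = (y_coord \<phi> + 1 + x_coord \<phi> ^ 2) / 2"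
  by (simp add: y_coord_def)

lemma riley_poly_quartic:
  "riley_poly x ((y + 1 + x ^ 2) / 2) = 0 \<longleftrightarrow> y ^ 2 = poly quartic x" for x y :: complex
proof -
  have "4 * riley_poly x ((y + 1 + x ^ 2) / 2) = y ^ 2 - poly quartic x"
    unfolding riley_poly_def poly_quartic by (simp add: field_simps) algebra
  then show ?thesis by (metis mult_eq_0_iff right_minus_eq zero_neq_numeral)
qed

lemma curve_equation: "\<phi> \<in> fig8_curve \<Longrightarrow> y_coord \<phi> ^ 2 = poly quartic (x_coord \<phi>)"
  unfolding fig8_curve_def riley_poly_quartic[symmetric] z_from_y[symmetric] by simp

lemma representation_coords:
  assumes AB: "representation A B" and \<phi>: "\<And>w. \<phi> (word_class w) = trace (word_mat A B w)"
  shows "trace A = x_coord \<phi>" "trace B = x_coord \<phi>" "trace (A ** B) = z_coord \<phi>"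
  using representation_trace[OF AB] by (simp_all add: x_coord_def z_coord_def \<phi>)

lemma character_word:
  assumes "\<phi> \<in> character_variety"
  shows "\<phi> (word_class w) = trace_quad (x_coord \<phi>) (z_coord \<phi>) (coeffs_word (x_coord \<phi>) (z_coord \<phi>) w)"
proof -
  obtain A B where AB: "representation A B" and \<phi>: "\<And>w. \<phi> (word_class w) = trace (word_mat A B w)"
    using character_variety_representation[OF assms] by blast
  show ?thesis
    unfolding \<phi>[of w]
    by (rule trace_word_mat) (use AB representation_coords[OF AB \<phi>] in \<open>auto simp: representation_def\<close>)
qed

text \<open>All points of the affine curve are characters; this is what makes distinct elements of
  \<open>curve_fun\<close> distinct functions.\<close>

lemma curve_point:
  assumes "y ^ 2 = poly quartic x"
  obtains \<phi> where "\<phi> \<in> fig8_curve" "x_coord \<phi> = x" "y_coord \<phi> = y"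
proof -
  define z where "z = (y + 1 + x ^ 2) / 2"
  have z: "riley_poly x z = 0" using assms riley_poly_quartic by (simp add: z_def)
  obtain A B where AB: "representation A B" "trace A = x" "trace (A ** B) = z"
    using representation_with_trace[OF z] by blast
  obtain \<phi> where \<phi>: "\<phi> \<in> character_variety" "\<And>w. \<phi> (word_class w) = trace (word_mat A B w)"
    using representation_character[OF AB(1)] by blast
  have c: "x_coord \<phi> = x" "z_coord \<phi> = z"
    using representation_coords[OF AB(1) \<phi>(2)] AB by auto
  have "y_coord \<phi> = y" by (simp add: y_coord_def c z_def field_simps)
  then show ?thesis
    using that[of \<phi>] \<phi>(1) z c by (simp add: fig8_curve_def)
qed

section \<open>Regular functions on the curve as elements of \<open>curve_fun\<close>\<close>

lemma eval_fun_simps: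
  "eval_fun (f + g) x y = eval_fun f x y + eval_fun g x y"
  "eval_fun (- f) x y = - eval_fun f x y"
  "eval_fun (f - g) x y = eval_fun f x y - eval_fun g x y"
  "eval_fun 0 x y = 0" "eval_fun 1 x y = 1" "eval_fun (const_fun c) x y = c"
  by (cases f; cases g; simp add: eval_fun_def zero_curve_fun_def one_curve_fun_def algebra_simps)+

lemma eval_fun_mult:
  "y ^ 2 = poly quartic x \<Longrightarrow> eval_fun (f * g) x y = eval_fun f x y * eval_fun g x y"
  by (cases f; cases g) (simp add: eval_fun_def power2_eq_square[symmetric] algebra_simps)

text \<open>On the curve the norm is h times its conjugate, so it vanishes for every x and is the
  zero polynomial.\<close>

lemma eval_fun_zeroI:
  assumes "\<And>x y. y ^ 2 = poly quartic x \<Longrightarrow> eval_fun h x y = 0"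
  shows "h = 0"
proof -
  have "poly (curve_norm h) x = 0" for x
  proof -
    define y where "y = csqrt (poly quartic x)"
    have y: "y ^ 2 = poly quartic x" by (simp add: y_def)
    have "poly (curve_norm h) x = eval_fun (h * conj_fun h) x y"
      unfolding mult_conj_fun by (simp add: eval_fun_def)
    then show ?thesis using assms[OF y] eval_fun_mult[OF y] by simp
  qed
  then show ?thesis using poly_all_0_iff_0[of "curve_norm h"] by simp
qed

definition z_fun :: curve_fun where
  "z_fun = CF [:1/2, 0, 1/2:] [:1/2:]"

definition trace_fun :: "word \<Rightarrow> curve_fun" where
  "trace_fun w = trace_quad x_fun z_fun (coeffs_word x_fun z_fun w)"

text \<open>Evaluation at a point is a ring homomorphism, so it commutes with each letter and with
  the fold over the word.\<close>

lemma eval_trace_fun: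
  assumes y: "y ^ 2 = poly quartic x"
  defines "z \<equiv> (y + 1 + x ^ 2) / 2"
  shows "eval_fun (trace_fun w) x y = trace_quad x z (coeffs_word x z w)"
proof -
  define E where "E f = eval_fun f x y" for f
  note E_simps = eval_fun_simps[where x = x and y = y, folded E_def] eval_fun_mult[OF y, folded E_def]
  define Q where "Q = (\<lambda>(c0, c1, c2, c3). (E c0, E c1, E c2, E c3))"
  have x: "E x_fun = x" by (simp add: E_def eval_fun_def)
  have z: "E z_fun = z" by (simp add: E_def eval_fun_def z_fun_def z_def power2_eq_square field_simps)
  have two: "E 2 = 2" using E_simps(1)[of 1 1] by (simp add: E_simps)
  have step: "Q (mult_letter x_fun z_fun l c) = mult_letter x z l (Q c)" for l c
  proof -
    obtain g s where l: "l = (g, s)" by (cases l)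
    obtain c0 c1 c2 c3 where c: "c = (c0, c1, c2, c3)" by (cases c)
    show ?thesis
      by (cases g; cases s) (simp_all add: l c Q_def E_simps x z del: curve_fun_arith)
  qed
  have Q: "Q (coeffs_word x_fun z_fun w) = coeffs_word x z w"
  proof (induction w rule: rev_induct)
    case Nil
    show ?case by (simp add: Q_def E_simps)
  next
    case (snoc l w)
    then show ?case by (simp only: coeffs_word_snoc step)
  qed
  obtain c0 c1 c2 c3 where c: "coeffs_word x_fun z_fun w = (c0, c1, c2, c3)"
    by (cases "coeffs_word x_fun z_fun w")
  have "coeffs_word x z w = (E c0, E c1, E c2, E c3)"
    using Q by (simp add: c Q_def)
  then show ?thesis
    by (simp add: trace_fun_def c E_simps x z two flip: E_def del: curve_fun_arith)
qed

lemma curve_word: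
  "\<phi> \<in> fig8_curve \<Longrightarrow> \<phi> (word_class w) = eval_fun (trace_fun w) (x_coord \<phi>) (y_coord \<phi>)"
  using character_word[of \<phi> w] eval_trace_fun[OF curve_equation, of \<phi> w]
  by (simp add: z_from_y fig8_curve_def)

definition regular :: "curve_fun \<Rightarrow> character \<Rightarrow> complex" where
  "regular h = zero_ext fig8_curve (\<lambda>\<phi>. eval_fun h (x_coord \<phi>) (y_coord \<phi>))"

lemma regular_add: "(\<lambda>\<phi>. regular f \<phi> + regular g \<phi>) = regular (f + g)"
  by (auto simp: regular_def zero_ext_def eval_fun_simps)

lemma regular_mult: "(\<lambda>\<phi>. regular f \<phi> * regular g \<phi>) = regular (f * g)"
  by (auto simp: regular_def zero_ext_def eval_fun_mult curve_equation)

lemma regular_const: "zero_ext fig8_curve (\<lambda>_. c) = regular (const_fun c)"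
  by (auto simp: regular_def zero_ext_def eval_fun_simps)

lemma regular_diff_const:
  "zero_ext fig8_curve (\<lambda>\<phi>. regular f \<phi> - c) = regular (f - const_fun c)"
  by (auto simp: regular_def zero_ext_def eval_fun_simps)

lemma regular_word: "zero_ext fig8_curve (\<lambda>\<phi>. \<phi> (word_class w)) = regular (trace_fun w)"
  by (auto simp: regular_def zero_ext_def curve_word)

lemma inj_regular: "inj regular"
proof (rule injI)
  fix f g assume eq: "regular f = regular g"
  have "f - g = 0"
  proof (rule eval_fun_zeroI)
    fix x y :: complex assume "y ^ 2 = poly quartic x"
    then obtain \<phi> where \<phi>: "\<phi> \<in> fig8_curve" "x_coord \<phi> = x" "y_coord \<phi> = y" by (rule curve_point)
    show "eval_fun (f - g) x y = 0"
      using fun_cong[OF eq, of \<phi>] \<phi> by (simp add: regular_def zero_ext_def eval_fun_simps)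
  qed
  then show "f = g" by simp
qed

lemma regular_zero: "regular 0 = (\<lambda>_. 0)"
  by (auto simp: regular_def zero_ext_def eval_fun_simps)

lemma trace_algebra_eval:
  "f \<in> trace_algebra \<Longrightarrow> \<exists>h. \<forall>\<phi>\<in>fig8_curve. f \<phi> = eval_fun h (x_coord \<phi>) (y_coord \<phi>)"
proof (induction rule: trace_algebra.induct)
  case (const c)
  show ?case by (intro exI[of _ "const_fun c"]) (simp add: eval_fun_simps)
next
  case (trace_function \<gamma>)
  then obtain w where "\<gamma> = word_class w" by (auto simp: carrier_fig8)
  then show ?case by (intro exI[of _ "trace_fun w"]) (simp add: curve_word)
next
  case (add f g)
  then obtain h k where "\<forall>\<phi>\<in>fig8_curve. f \<phi> = eval_fun h (x_coord \<phi>) (y_coord \<phi>)"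
    "\<forall>\<phi>\<in>fig8_curve. g \<phi> = eval_fun k (x_coord \<phi>) (y_coord \<phi>)" by blast
  then show ?case by (intro exI[of _ "h + k"]) (simp add: eval_fun_simps)
next
  case (mult f g)
  then obtain h k where "\<forall>\<phi>\<in>fig8_curve. f \<phi> = eval_fun h (x_coord \<phi>) (y_coord \<phi>)"
    "\<forall>\<phi>\<in>fig8_curve. g \<phi> = eval_fun k (x_coord \<phi>) (y_coord \<phi>)" by blast
  then show ?case by (intro exI[of _ "h * k"]) (simp add: eval_fun_mult curve_equation)
qed

lemma x_coord_trace_algebra: "x_coord \<in> trace_algebra"
  using trace_algebra.trace_function[OF word_class_in_carrier[of "[(Alpha, True)]"]]
  by (simp add: x_coord_def[abs_def])

lemma z_coord_trace_algebra: "z_coord \<in> trace_algebra"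
  using trace_algebra.trace_function[OF word_class_in_carrier[of "[(Alpha, True), (Beta, True)]"]]
  by (simp add: z_coord_def[abs_def])

lemma y_coord_trace_algebra: "y_coord \<in> trace_algebra"
proof -
  have "(\<lambda>\<phi>. 2 * z_coord \<phi> + (-1 + (-1) * (x_coord \<phi> * x_coord \<phi>))) \<in> trace_algebra"
    by (intro trace_algebra.intros x_coord_trace_algebra z_coord_trace_algebra)
  moreover have "(\<lambda>\<phi>. 2 * z_coord \<phi> + (-1 + (-1) * (x_coord \<phi> * x_coord \<phi>))) = y_coord"
    by (auto simp: y_coord_def power2_eq_square)
  ultimately show ?thesis by simp
qed

lemma poly_trace_algebra: "(\<lambda>\<phi>. poly p (x_coord \<phi>)) \<in> trace_algebra"
proof (induction p)
  case 0
  then show ?case using trace_algebra.const[of 0] by simp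
next
  case (pCons c p)
  have "(\<lambda>\<phi>. c + x_coord \<phi> * poly p (x_coord \<phi>)) \<in> trace_algebra"
    by (intro trace_algebra.intros x_coord_trace_algebra pCons.IH)
  then show ?case by simp
qed

lemma coordinate_ring_eq: "coordinate_ring fig8_curve = range regular"
proof (intro equalityI subsetI)
  fix F assume "F \<in> coordinate_ring fig8_curve"
  then obtain f where f: "f \<in> trace_algebra" "F = zero_ext fig8_curve f"
    by (auto simp: coordinate_ring_def)
  then obtain h where "\<forall>\<phi>\<in>fig8_curve. f \<phi> = eval_fun h (x_coord \<phi>) (y_coord \<phi>)"
    using trace_algebra_eval by blast
  then have "F = regular h" by (auto simp: f regular_def zero_ext_def)
  then show "F \<in> range regular" by simp
next
  fix F assume "F \<in> range regular"
  then obtain h where F: "F = regular h" by blast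
  have "(\<lambda>\<phi>. eval_fun h (x_coord \<phi>) (y_coord \<phi>)) \<in> trace_algebra"
    unfolding eval_fun_def
    by (intro trace_algebra.intros poly_trace_algebra y_coord_trace_algebra)
  then show "F \<in> coordinate_ring fig8_curve"
    by (auto simp: F regular_def coordinate_ring_def)
qed

section \<open>The curve as an irreducible component\<close>

lemma zariski_closed_curve: "zariski_closed fig8_curve"
proof -
  define F where "F \<phi> = riley_poly (x_coord \<phi>) (z_coord \<phi>)" for \<phi>
  have "(\<lambda>\<phi>. z_coord \<phi> * z_coord \<phi> + ((-1) * ((1 + x_coord \<phi> * x_coord \<phi>) * z_coord \<phi>) +
      (2 * (x_coord \<phi> * x_coord \<phi>) + (-1)))) \<in> trace_algebra"
    by (intro trace_algebra.intros x_coord_trace_algebra z_coord_trace_algebra)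
  moreover have "(\<lambda>\<phi>. z_coord \<phi> * z_coord \<phi> + ((-1) * ((1 + x_coord \<phi> * x_coord \<phi>) * z_coord \<phi>) +
      (2 * (x_coord \<phi> * x_coord \<phi>) + (-1)))) = F"
    by (auto simp: F_def riley_poly_def)
  ultimately have "F \<in> trace_algebra" by simp
  then show ?thesis
    unfolding zariski_closed_def
    by (intro exI[of _ "{F}"]) (auto simp: F_def fig8_curve_def)
qed

text \<open>Two functions that cut out a proper decomposition would have product 0 in
  \<open>curve_fun\<close>, which is a domain.\<close>

lemma zariski_irreducible_curve: "zariski_irreducible fig8_curve"
  unfolding zariski_irreducible_def
proof (intro conjI allI impI)
  obtain \<phi> where "\<phi> \<in> fig8_curve"
    using curve_point[of "csqrt (poly quartic 0)" 0] by auto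
  then show "fig8_curve \<noteq> {}" by blast
next
  fix Z1 Z2
  assume Z: "zariski_closed Z1 \<and> zariski_closed Z2 \<and> fig8_curve = Z1 \<union> Z2"
  obtain S1 S2 where S: "S1 \<subseteq> trace_algebra" "Z1 = {\<phi> \<in> character_variety. \<forall>f\<in>S1. f \<phi> = 0}"
    "S2 \<subseteq> trace_algebra" "Z2 = {\<phi> \<in> character_variety. \<forall>f\<in>S2. f \<phi> = 0}"
    using Z unfolding zariski_closed_def by blast
  show "fig8_curve = Z1 \<or> fig8_curve = Z2"
  proof (rule ccontr)
    assume "\<not> (fig8_curve = Z1 \<or> fig8_curve = Z2)"
    then obtain \<phi>1 \<phi>2 where "\<phi>1 \<in> fig8_curve" "\<phi>1 \<notin> Z1" "\<phi>2 \<in> fig8_curve" "\<phi>2 \<notin> Z2"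
      using Z by blast
    moreover have "fig8_curve \<subseteq> character_variety" by (auto simp: fig8_curve_def)
    ultimately obtain f1 f2 where f: "f1 \<in> S1" "f1 \<phi>1 \<noteq> 0" "f2 \<in> S2" "f2 \<phi>2 \<noteq> 0"
      using S by blast
    obtain h1 h2 where h: "\<forall>\<phi>\<in>fig8_curve. f1 \<phi> = eval_fun h1 (x_coord \<phi>) (y_coord \<phi>)"
      "\<forall>\<phi>\<in>fig8_curve. f2 \<phi> = eval_fun h2 (x_coord \<phi>) (y_coord \<phi>)"
      using trace_algebra_eval f S by blast
    have "h1 * h2 = 0"
    proof (rule eval_fun_zeroI)
      fix x y :: complex assume y: "y ^ 2 = poly quartic x"
      then obtain \<phi> where \<phi>: "\<phi> \<in> fig8_curve" "x_coord \<phi> = x" "y_coord \<phi> = y" by (rule curve_point)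
      then have "\<phi> \<in> Z1 \<or> \<phi> \<in> Z2" using Z by blast
      then have "f1 \<phi> = 0 \<or> f2 \<phi> = 0" using f S by blast
      then show "eval_fun (h1 * h2) x y = 0" using h \<phi> by (auto simp: eval_fun_mult[OF y])
    qed
    then have "h1 = 0 \<or> h2 = 0" by simp
    then show False
      using h f \<open>\<phi>1 \<in> fig8_curve\<close> \<open>\<phi>2 \<in> fig8_curve\<close> by (auto simp: eval_fun_simps)
  qed
qed

lemma zariski_closed_Int: "zariski_closed Y \<Longrightarrow> zariski_closed Z \<Longrightarrow> zariski_closed (Y \<inter> Z)"
proof -
  assume "zariski_closed Y" "zariski_closed Z"
  then obtain S T where "S \<subseteq> trace_algebra" "Y = {\<phi> \<in> character_variety. \<forall>f\<in>S. f \<phi> = 0}"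
    "T \<subseteq> trace_algebra" "Z = {\<phi> \<in> character_variety. \<forall>f\<in>T. f \<phi> = 0}"
    unfolding zariski_closed_def by blast
  then show ?thesis
    unfolding zariski_closed_def by (intro exI[of _ "S \<union> T"]) auto
qed

lemma canonical_component_eq:
  assumes X: "canonical_component X"
  shows "X = fig8_curve"
proof -
  define L where "L = {\<phi> \<in> character_variety. z_coord \<phi> = x_coord \<phi> * x_coord \<phi> - 2}"
  have "(\<lambda>\<phi>. z_coord \<phi> + ((-1) * (x_coord \<phi> * x_coord \<phi>) + 2)) \<in> trace_algebra"
    by (intro trace_algebra.intros x_coord_trace_algebra z_coord_trace_algebra)
  then have L: "zariski_closed L"
    unfolding zariski_closed_def
    by (intro exI[of _ "{\<lambda>\<phi>. z_coord \<phi> + ((-1) * (x_coord \<phi> * x_coord \<phi>) + 2)}"])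
      (auto simp: L_def algebra_simps)
  obtain \<rho> where irr: "irreducible_component X" and \<rho>: "discrete_faithful \<rho>" "character_of \<rho> \<in> X"
    using X by (auto simp: canonical_component_def)
  have Xc: "zariski_closed X" and Xi: "zariski_irreducible X"
    and max: "\<And>Y. zariski_closed Y \<Longrightarrow> zariski_irreducible Y \<Longrightarrow> X \<subseteq> Y \<Longrightarrow> Y = X"
    using irr by (auto simp: irreducible_component_def)
  have XV: "X \<subseteq> character_variety" using Xc by (auto simp: zariski_closed_def)
  have hom: "\<rho> \<in> hom fig8_group SL2C" and inj: "inj_on \<rho> (carrier fig8_group)"
    using \<rho>(1) by (auto simp: discrete_faithful_def)
  obtain A B where AB: "representation A B" "\<And>w. \<rho> (word_class w) = word_mat A B w"
    using hom_word_mat[OF hom] by metis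
  have \<phi>: "character_of \<rho> (word_class w) = trace (word_mat A B w)" for w
    by (simp add: character_of_def AB)
  have "character_of \<rho> \<notin> L"
    using faithful_trace[OF hom inj AB] representation_coords[OF AB(1) \<phi>] by (simp add: L_def)
  moreover have "X \<subseteq> L \<union> fig8_curve"
  proof
    fix \<psi> assume "\<psi> \<in> X"
    then have \<psi>: "\<psi> \<in> character_variety" using XV by blast
    then obtain A' B' where "representation A' B'" "\<And>w. \<psi> (word_class w) = trace (word_mat A' B' w)"
      using character_variety_representation by blast
    from representation_cases[OF this(1) HOL.refl HOL.refl] representation_coords[OF this]
    show "\<psi> \<in> L \<union> fig8_curve" using \<psi> by (auto simp: L_def fig8_curve_def)
  qed
  \<comment> \<open>Irreducibility puts X inside one of the two curves. The faithful character is
    off \<open>L\<close>, and maximality of a component turns the remaining inclusion into an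
    equality.\<close>
  then have "X = (X \<inter> L) \<union> (X \<inter> fig8_curve)" by blast
  then have "X = X \<inter> L \<or> X = X \<inter> fig8_curve"
    using Xi[unfolded zariski_irreducible_def] zariski_closed_Int[OF Xc L]
      zariski_closed_Int[OF Xc zariski_closed_curve] by metis
  ultimately have "X \<subseteq> fig8_curve" using \<rho>(2) by blast
  then show ?thesis
    using max[OF zariski_closed_curve zariski_irreducible_curve] by simp
qed


section \<open>Degrees\<close>

lemma nonzero_regular_eq: "nonzero_regular fig8_curve = regular ` (- {0})"
  unfolding nonzero_regular_def coordinate_ring_eq regular_zero[symmetric]
  using inj_regular by (auto simp: inj_eq)

text \<open>The value 0 off the regular functions is the last clause of \<open>smooth_model\<close>;
  at the zero function that clause is met through \<open>v_zero\<close>.\<close>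

definition extend_place :: "(curve_fun \<Rightarrow> int) \<Rightarrow> (character \<Rightarrow> complex) \<Rightarrow> int" where
  "extend_place w F = (if F \<in> range regular then w (inv_into UNIV regular F) else 0)"

lemma extend_place_regular [simp]: "extend_place w (regular h) = w h"
  by (simp add: extend_place_def inv_f_f[OF inj_regular])

lemma regular_eq_iff [simp]: "regular f = regular g \<longleftrightarrow> f = g"
  using inj_regular by (auto simp: inj_eq)

lemma regular_in_nonzero [simp]: "regular h \<in> nonzero_regular fig8_curve \<longleftrightarrow> h \<noteq> 0"
  by (auto simp: nonzero_regular_eq)

lemma smooth_model_iff:
  "v \<in> smooth_model fig8_curve \<longleftrightarrow>
    (\<forall>f. f \<noteq> 0 \<longrightarrow> (\<forall>g. g \<noteq> 0 \<longrightarrow> v (regular (f * g)) = v (regular f) + v (regular g))) \<and>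
    (\<forall>f. f \<noteq> 0 \<longrightarrow> (\<forall>g. g \<noteq> 0 \<longrightarrow> f + g \<noteq> 0 \<longrightarrow>
      min (v (regular f)) (v (regular g)) \<le> v (regular (f + g)))) \<and>
    (\<forall>c. c \<noteq> 0 \<longrightarrow> v (regular (const_fun c)) = 0) \<and>
    (\<exists>f. f \<noteq> 0 \<and> (\<exists>g. g \<noteq> 0 \<and> v (regular f) - v (regular g) = 1)) \<and>
    (\<forall>F. F \<notin> regular ` (- {0}) \<longrightarrow> v F = 0)"
proof -
  have ball: "(\<forall>F\<in>nonzero_regular fig8_curve. P F) \<longleftrightarrow> (\<forall>f. f \<noteq> 0 \<longrightarrow> P (regular f))" for P
    by (auto simp: nonzero_regular_eq)
  have bex: "(\<exists>F\<in>nonzero_regular fig8_curve. P F) \<longleftrightarrow> (\<exists>f. f \<noteq> 0 \<and> P (regular f))" for P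
    by (auto simp: nonzero_regular_eq)
  show ?thesis
    unfolding smooth_model_def mem_Collect_eq ball bex regular_mult regular_add regular_const
      regular_in_nonzero
    unfolding nonzero_regular_eq ..
qed

lemma bij_betw_extend_place: "bij_betw extend_place places (smooth_model fig8_curve)"
proof (rule bij_betw_imageI)
  show "inj_on extend_place places"
  proof (rule inj_onI)
    fix v w assume eq: "extend_place v = extend_place w"
    show "v = w"
    proof
      fix h show "v h = w h" using fun_cong[OF eq, of "regular h"] by simp
    qed
  qed
  show "extend_place ` places = smooth_model fig8_curve"
  proof (intro equalityI subsetI)
    fix v assume "v \<in> extend_place ` places"
    then obtain w where w: "v = extend_place w" "curve_valuation w" by (auto simp: places_def)
    have "v F = 0" if "F \<notin> regular ` (- {0})" for F
      using that curve_valuation.v_zero[OF w(2)] unfolding w(1)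
      by (cases "F \<in> range regular") (auto simp: extend_place_def inv_f_f[OF inj_regular])
    then show "v \<in> smooth_model fig8_curve"
      using w unfolding smooth_model_iff curve_valuation_def by simp
  next
    fix v assume v: "v \<in> smooth_model fig8_curve"
    note c = v[unfolded smooth_model_iff]
    note m = c[THEN conjunct1] c[THEN conjunct2, THEN conjunct1]
      c[THEN conjunct2, THEN conjunct2, THEN conjunct1]
      c[THEN conjunct2, THEN conjunct2, THEN conjunct2, THEN conjunct1]
    note out = c[THEN conjunct2, THEN conjunct2, THEN conjunct2, THEN conjunct2]
    define w where "w h = v (regular h)" for h
    have "regular 0 \<notin> regular ` (- {0})" by auto
    then have "v (regular 0) = 0" using out by blast
    then have "curve_valuation w"
      using m by unfold_locales (auto simp: w_def)
    moreover have "v = extend_place w"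
    proof
      fix F
      have "v F = 0" if "F \<notin> range regular"
        using out that by blast
      moreover have "v (regular h) = extend_place w (regular h)" for h by (simp add: w_def)
      ultimately show "v F = extend_place w F"
        by (cases "F \<in> range regular") (blast, simp add: extend_place_def)
    qed
    ultimately show "v \<in> extend_place ` places" by (auto simp: places_def)
  qed
qed

lemma sum_smooth_model:
  "(\<Sum>v | v \<in> smooth_model fig8_curve \<and> P v. F v) =
    (\<Sum>w | w \<in> places \<and> P (extend_place w). F (extend_place w))"
proof -
  have "bij_betw extend_place {w. w \<in> places \<and> P (extend_place w)}
      {v. v \<in> smooth_model fig8_curve \<and> P v}"
    using bij_betw_extend_place unfolding bij_betw_def by (auto simp: inj_on_def)
  from sum.reindex_bij_betw[OF this, of F] show ?thesis by simp
qed

lemma preimages_regular: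
  assumes "\<And>c. f \<noteq> const_fun c"
  shows "preimages fig8_curve (regular f) y = (\<Sum>v\<in>infinite_places. max 0 (- v f))"
proof (cases y)
  case None
  then show ?thesis using sum_poles[of f] by (simp add: sum_smooth_model)
next
  case (Some c)
  then show ?thesis
    using sum_zeros[OF assms, of c] by (simp add: sum_smooth_model regular_diff_const)
qed

lemma max_constant: "v \<in> places \<Longrightarrow> max 0 (- v (const_fun c)) = 0"
  using curve_valuation.v_const[of v c] curve_valuation.v_zero[of v]
  by (cases "c = 0") (auto simp: places_def zero_curve_fun_def)

text \<open>All fibres, the one over infinity included, have the same count, which is what
  \<open>THE\<close> needs. Constants have degree 0 by definition and no poles, so the formula
  covers them too.\<close>

lemma map_degree_regular:
  "map_degree fig8_curve (regular f) = (\<Sum>v\<in>infinite_places. max 0 (- v f))"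
proof (cases "\<exists>c. f = const_fun c")
  case True
  then have "(\<Sum>v\<in>infinite_places. max 0 (- v f)) = 0"
    using max_constant by (auto simp: infinite_places_def intro!: sum.neutral)
  then show ?thesis using True by (simp add: map_degree_def regular_const)
next
  case False
  then have "preimages fig8_curve (regular f) y = (\<Sum>v\<in>infinite_places. max 0 (- v f))" for y
    by (intro preimages_regular) auto
  then show ?thesis using False by (simp add: map_degree_def regular_const)
qed

section \<open>Peripheral trace functions\<close>

text \<open>Both traces are reduced modulo the equation of the curve. That of \<lambda> involves x
  alone; that of \<alpha> \<lambda> is linear in z and will tell the two eigenvalues of the
  longitude apart.\<close>

lemma coeffs_word_longitude:
  fixes x z :: "'a::idom"
  assumes "riley_poly x z = 0"
  defines "l \<equiv> [(Beta, False), (Alpha, True), (Beta, True), (Alpha, False),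
     (Alpha, False), (Beta, True), (Alpha, True), (Beta, False)]"
  shows "trace_quad x z (coeffs_word x z l) = x ^ 4 - 5 * x ^ 2 + 2"
    and "trace_quad x z (coeffs_word x z ((Alpha, True) # l)) =
      x ^ 5 - 4 * x ^ 3 - x + (4 * x - x ^ 3) * z"
proof -
  show "trace_quad x z (coeffs_word x z l) = x ^ 4 - 5 * x ^ 2 + 2"
    using assms(1) unfolding l_def riley_poly_def
    by (simp add: coeffs_word_def) algebra
  show "trace_quad x z (coeffs_word x z ((Alpha, True) # l)) =
      x ^ 5 - 4 * x ^ 3 - x + (4 * x - x ^ 3) * z"
    using assms(1) unfolding l_def riley_poly_def
    by (simp add: coeffs_word_def) algebra
qed

lemma trace_adj2: "trace (M ** adj2 N) = trace M * trace N - trace (M ** N)"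
  and trace_adj2': "trace (adj2 M ** N) = trace M * trace N - trace (M ** N)"
  by (simp_all add: mat2_trace mat2_mult adj2_entries algebra_simps)

lemma word_mat_inv_eq:
  assumes "det A = 1" "det B = 1"
  shows "word_mat A B (inv_word w) = adj2 (word_mat A B w)"
proof -
  have "adj2 (word_mat A B w) ** word_mat A B w = mat 1"
    using adj2_mult(2) det_word_mat[OF assms] by blast
  then show ?thesis
    using word_mat_inv_word[OF assms, of w] by (metis matrix_mul_assoc matrix_mul_lid matrix_mul_rid)
qed

lemma character_mult:
  assumes \<phi>: "\<phi> \<in> character_variety" and gh: "g \<in> carrier fig8_group" "h \<in> carrier fig8_group"
  shows "\<phi> (g \<otimes>\<^bsub>fig8_group\<^esub> h) + \<phi> (g \<otimes>\<^bsub>fig8_group\<^esub> inv\<^bsub>fig8_group\<^esub> h) = \<phi> g * \<phi> h"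
    and "\<phi> (g \<otimes>\<^bsub>fig8_group\<^esub> h) + \<phi> (inv\<^bsub>fig8_group\<^esub> g \<otimes>\<^bsub>fig8_group\<^esub> h) = \<phi> g * \<phi> h"
proof -
  obtain A B where AB: "representation A B" and t: "\<And>w. \<phi> (word_class w) = trace (word_mat A B w)"
    using character_variety_representation[OF \<phi>] by blast
  have d: "det A = 1" "det B = 1" using AB by (auto simp: representation_def)
  obtain u w where "g = word_class u" "h = word_class w" using gh by (auto simp: carrier_fig8)
  then show "\<phi> (g \<otimes>\<^bsub>fig8_group\<^esub> h) + \<phi> (g \<otimes>\<^bsub>fig8_group\<^esub> inv\<^bsub>fig8_group\<^esub> h) = \<phi> g * \<phi> h"
    and "\<phi> (g \<otimes>\<^bsub>fig8_group\<^esub> h) + \<phi> (inv\<^bsub>fig8_group\<^esub> g \<otimes>\<^bsub>fig8_group\<^esub> h) = \<phi> g * \<phi> h"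
    by (simp_all add: inv_word_class mult_word_class t word_mat_inv_eq[OF d] trace_adj2 trace_adj2')
qed

lemma peripheral_in_carrier: "peripheral p q \<in> carrier fig8_group"
  and meridian_in_carrier: "meridian \<in> carrier fig8_group"
  and longitude_in_carrier: "longitude \<in> carrier fig8_group"
proof -
  interpret group fig8_group by (rule group_fig8)
  show "meridian \<in> carrier fig8_group" "longitude \<in> carrier fig8_group"
    by (simp_all add: meridian_def longitude_def)
  then show "peripheral p q \<in> carrier fig8_group" by (simp add: peripheral_def)
qed

text \<open>In \<open>peripheral p q\<close> the meridian power stands on the left and the longitude
  power on the right, so p is shifted from the left and q from the right. Hence the two versions of
  the trace identity in \<open>character_mult\<close>.\<close>

lemma peripheral_shift:
  shows "peripheral (p + 1) q = meridian \<otimes>\<^bsub>fig8_group\<^esub> peripheral p q"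
    and "peripheral (p - 1) q = inv\<^bsub>fig8_group\<^esub> meridian \<otimes>\<^bsub>fig8_group\<^esub> peripheral p q"
    and "peripheral p (q + 1) = peripheral p q \<otimes>\<^bsub>fig8_group\<^esub> longitude"
    and "peripheral p (q - 1) = peripheral p q \<otimes>\<^bsub>fig8_group\<^esub> inv\<^bsub>fig8_group\<^esub> longitude"
proof -
  interpret group fig8_group by (rule group_fig8)
  note c = meridian_in_carrier longitude_in_carrier
  have m: "g [^]\<^bsub>fig8_group\<^esub> (1::int) = g" "g [^]\<^bsub>fig8_group\<^esub> (-1::int) = inv\<^bsub>fig8_group\<^esub> g"
    if "g \<in> carrier fig8_group" for g
    using that by (simp_all add: int_pow_1 int_pow_neg)
  show "peripheral (p + 1) q = meridian \<otimes>\<^bsub>fig8_group\<^esub> peripheral p q"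
    using int_pow_mult[OF c(1), of 1 p] c m by (simp add: peripheral_def m_assoc add.commute)
  show "peripheral (p - 1) q = inv\<^bsub>fig8_group\<^esub> meridian \<otimes>\<^bsub>fig8_group\<^esub> peripheral p q"
    using int_pow_mult[OF c(1), of "-1" p] c m by (simp add: peripheral_def m_assoc)
  show "peripheral p (q + 1) = peripheral p q \<otimes>\<^bsub>fig8_group\<^esub> longitude"
    using int_pow_mult[OF c(2), of q 1] c m by (simp add: peripheral_def m_assoc)
  show "peripheral p (q - 1) = peripheral p q \<otimes>\<^bsub>fig8_group\<^esub> inv\<^bsub>fig8_group\<^esub> longitude"
    using int_pow_mult[OF c(2), of q "-1"] c m by (simp add: peripheral_def m_assoc)
qed

definition periph_fun :: "int \<Rightarrow> int \<Rightarrow> curve_fun" where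
  "periph_fun p q = inv_into UNIV regular (zero_ext fig8_curve (\<lambda>\<phi>. \<phi> (peripheral p q)))"

lemma periph_fun_eqI:
  "peripheral p q = word_class w \<Longrightarrow> periph_fun p q = trace_fun w"
  by (simp add: periph_fun_def regular_word inv_f_f[OF inj_regular])

lemma regular_periph_fun:
  "regular (periph_fun p q) = zero_ext fig8_curve (\<lambda>\<phi>. \<phi> (peripheral p q))"
proof -
  obtain w where "peripheral p q = word_class w"
    using peripheral_in_carrier[of p q] by (auto simp: carrier_fig8)
  then show ?thesis using periph_fun_eqI by (simp add: regular_word)
qed

lemma f_gamma_regular:
  "f_gamma fig8_curve (peripheral p q) = regular (periph_fun p q * periph_fun p q - const_fun 4)"
  unfolding regular_diff_const[symmetric] regular_mult[symmetric] regular_periph_fun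
  by (auto simp: f_gamma_def zero_ext_def power2_eq_square)

definition long_fun :: curve_fun where
  "long_fun = CF [:2, 0, -5, 0, 1:] 0"

lemma eval_fun_eqI:
  assumes "\<And>x y. y ^ 2 = poly quartic x \<Longrightarrow> eval_fun f x y = eval_fun g x y"
  shows "f = g"
proof -
  have "f - g = 0" by (rule eval_fun_zeroI) (simp add: assms eval_fun_simps)
  then show ?thesis by simp
qed

lemma peripheral_base:
  "peripheral 0 0 = word_class []" "peripheral 1 0 = meridian" "peripheral 0 1 = longitude"
  "peripheral 1 1 = meridian \<otimes>\<^bsub>fig8_group\<^esub> longitude"
proof -
  interpret group fig8_group by (rule group_fig8)
  show "peripheral 0 0 = word_class []" "peripheral 1 0 = meridian" "peripheral 0 1 = longitude"
    "peripheral 1 1 = meridian \<otimes>\<^bsub>fig8_group\<^esub> longitude"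
    using meridian_in_carrier longitude_in_carrier
    by (simp_all add: peripheral_def int_pow_1 flip: one_fig8)
qed

text \<open>The initial values for the recurrences in p and q. The last one is doubled to clear the
  denominator of z = (y + 1 + x^2) / 2.\<close>

lemma periph_fun_base:
  "periph_fun 0 0 = 2" "periph_fun 1 0 = x_fun" "periph_fun 0 1 = long_fun"
  "2 * periph_fun 1 1 = CF [:0, 2, 0, -5, 0, 1:] [:0, 4, 0, -1:]"
proof -
  show "periph_fun 0 0 = 2"
    using periph_fun_eqI[OF peripheral_base(1)] by (simp add: trace_fun_def del: curve_fun_arith)
  show "periph_fun 1 0 = x_fun"
    using periph_fun_eqI[OF peripheral_base(2)[unfolded meridian_def]]
    by (simp add: trace_fun_def coeffs_word_def del: curve_fun_arith)
  have eval: "eval_fun (periph_fun 0 1) x y = x ^ 4 - 5 * x ^ 2 + 2"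
    "eval_fun (periph_fun 1 1) x y = x ^ 5 - 4 * x ^ 3 - x + (4 * x - x ^ 3) * ((y + 1 + x ^ 2) / 2)"
    if y: "y ^ 2 = poly quartic x" for x y
  proof -
    have z: "riley_poly x ((y + 1 + x ^ 2) / 2) = 0" using y riley_poly_quartic by blast
    show "eval_fun (periph_fun 0 1) x y = x ^ 4 - 5 * x ^ 2 + 2"
      unfolding periph_fun_eqI[OF peripheral_base(3)[unfolded longitude_def]] eval_trace_fun[OF y]
      by (rule coeffs_word_longitude(1)[OF z])
    have "peripheral 1 1 = word_class ((Alpha, True) #
      [(Beta, False), (Alpha, True), (Beta, True), (Alpha, False),
       (Alpha, False), (Beta, True), (Alpha, True), (Beta, False)])"
      unfolding peripheral_base(4) meridian_def longitude_def mult_word_class by simp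
    from periph_fun_eqI[OF this]
    show "eval_fun (periph_fun 1 1) x y = x ^ 5 - 4 * x ^ 3 - x + (4 * x - x ^ 3) * ((y + 1 + x ^ 2) / 2)"
      by (simp only: eval_trace_fun[OF y]) (rule coeffs_word_longitude(2)[OF z])
  qed
  show "periph_fun 0 1 = long_fun"
    by (rule eval_fun_eqI) (simp add: eval long_fun_def, simp add: eval_fun_def algebra_simps
      power2_eq_square power4_eq_xxxx)
  show "2 * periph_fun 1 1 = CF [:0, 2, 0, -5, 0, 1:] [:0, 4, 0, -1:]"
  proof (rule eval_fun_eqI)
    fix x y :: complex assume y: "y ^ 2 = poly quartic x"
    have "eval_fun (2 * periph_fun 1 1) x y = 2 * eval_fun (periph_fun 1 1) x y"
      unfolding mult_2 eval_fun_simps(1) ..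
    also have "\<dots> = 2 * (x ^ 5 - 4 * x ^ 3 - x) + (4 * x - x ^ 3) * (y + 1 + x ^ 2)"
      unfolding eval(2)[OF y] by (simp add: field_simps)
    also have "\<dots> = eval_fun (CF [:0, 2, 0, -5, 0, 1:] [:0, 4, 0, -1:]) x y"
      by (simp add: eval_fun_def) algebra
    finally show "eval_fun (2 * periph_fun 1 1) x y = eval_fun (CF [:0, 2, 0, -5, 0, 1:] [:0, 4, 0, -1:]) x y" .
  qed
qed

lemma periph_fun_rec:
  "periph_fun (p + 1) q + periph_fun (p - 1) q = x_fun * periph_fun p q"
  "periph_fun p (q + 1) + periph_fun p (q - 1) = long_fun * periph_fun p q"
proof -
  have V: "\<phi> \<in> fig8_curve \<Longrightarrow> \<phi> \<in> character_variety" for \<phi> by (simp add: fig8_curve_def)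
  have ml: "regular x_fun = zero_ext fig8_curve (\<lambda>\<phi>. \<phi> meridian)"
    "regular long_fun = zero_ext fig8_curve (\<lambda>\<phi>. \<phi> longitude)"
    using regular_periph_fun[of 1 0] regular_periph_fun[of 0 1] by (simp_all add: periph_fun_base peripheral_base)
  have "regular (periph_fun (p + 1) q + periph_fun (p - 1) q) = regular (x_fun * periph_fun p q)"
    unfolding regular_mult[symmetric] regular_add[symmetric] regular_periph_fun ml peripheral_shift
    using character_mult(2)[OF V meridian_in_carrier peripheral_in_carrier]
    by (auto simp: zero_ext_def)
  then show "periph_fun (p + 1) q + periph_fun (p - 1) q = x_fun * periph_fun p q" by simp
  have "regular (periph_fun p (q + 1) + periph_fun p (q - 1)) = regular (periph_fun p q * long_fun)"
    unfolding regular_mult[symmetric] regular_add[symmetric] regular_periph_fun ml peripheral_shift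
    using character_mult(1)[OF V peripheral_in_carrier longitude_in_carrier]
    by (auto simp: zero_ext_def)
  then show "periph_fun p (q + 1) + periph_fun p (q - 1) = long_fun * periph_fun p q"
    by (simp add: mult.commute)
qed

section \<open>Peripheral eigenvalues as Laurent series at infinity\<close>

lemma recurrence_unique:
  fixes F G :: "int \<Rightarrow> 'a::comm_ring_1"
  assumes F: "\<And>n. F (n + 1) + F (n - 1) = k * F n" and G: "\<And>n. G (n + 1) + G (n - 1) = k * G n"
    and base: "F 0 = G 0" "F 1 = G 1"
  shows "F n = G n"
proof -
  have up: "F (int m) = G (int m) \<and> F (int m + 1) = G (int m + 1)" for m
  proof (induction m)
    case (Suc m)
    have "F (int m + 1 + 1) = k * F (int m + 1) - F (int m + 1 - 1)"
      using F[of "int m + 1"] by (simp add: eq_diff_eq)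
    also have "\<dots> = G (int m + 1 + 1)"
      using G[of "int m + 1"] Suc by (simp add: diff_eq_eq)
    finally show ?case using Suc by (simp add: add.commute)
  qed (use base in simp)
  have down: "F (- int m) = G (- int m) \<and> F (1 - int m) = G (1 - int m)" for m
  proof (induction m)
    case (Suc m)
    have "F (- int m - 1) = k * F (- int m) - F (- int m + 1)"
      using F[of "- int m"] by (simp add: eq_diff_eq add.commute)
    also have "\<dots> = G (- int m - 1)"
      using G[of "- int m"] Suc by (simp add: diff_eq_eq add.commute)
    finally have "F (- int m - 1) = G (- int m - 1)" .
    moreover have "- int (Suc m) = - int m - 1" "1 - int (Suc m) = - int m" by simp_all
    ultimately show ?case using Suc by (simp only:)
  qed (use base in simp)
  show ?thesis
    using up[of "nat n"] down[of "nat (- n)"] by (cases "0 \<le> n") auto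
qed

text \<open>The upper left entry of the longitude in the representation where the meridian has
  upper left entry \<open>m = 1/t\<close>.\<close>

definition long_eigen :: "complex fls \<Rightarrow> complex fls" where
  "long_eigen Y = (X_inf ^ 4 - 5 * X_inf ^ 2 + 2 - (fls_X_inv ^ 2 - fls_X ^ 2) * Y) / 2"

lemma series_point_uminus: "series_point X Y \<Longrightarrow> series_point X (- Y)"
  by (simp add: series_point_def)

context
  fixes Y
  assumes Y: "series_point X_inf Y"
begin

interpretation series_point X_inf Y by (rule Y)

lemma Y_square: "Y ^ 2 = X_inf ^ 4 - 6 * X_inf ^ 2 + 5"
  unfolding eq by (simp add: quartic_def algebra_simps power2_eq_square power4_eq_xxxx)

text \<open>With L = x^4 - 5 x^2 + 2 one has L^2 - 4 = x^2 (x^2 - 4) (x^2 - 1) (x^2 - 5), where the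
  first two factors give (m^2 - m^-2)^2 and the last two y^2. So the sign of Y selects one of two
  inverse eigenvalues.\<close>

lemma long_eigen_mult: "long_eigen Y * long_eigen (- Y) = 1"
proof -
  define u t where "u = (fls_X_inv :: complex fls)" and "t = (fls_X :: complex fls)"
  have ut: "u * t = 1" by (simp add: u_def t_def fls_X_inv_mult_X)
  have X: "X_inf = u + t" by (simp add: X_inf_def u_def t_def)
  have "4 * (long_eigen Y * long_eigen (- Y)) =
      (X_inf ^ 4 - 5 * X_inf ^ 2 + 2) ^ 2 - (u ^ 2 - t ^ 2) ^ 2 * Y ^ 2"
    by (simp add: long_eigen_def u_def t_def field_simps power2_eq_square)
  also have "\<dots> = 4" unfolding Y_square X using ut by algebra
  finally show ?thesis by simp
qed

lemma embed_long_fun: "embed X_inf Y long_fun = X_inf ^ 4 - 5 * X_inf ^ 2 + 2"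
  by (simp add: long_fun_def algebra_simps power2_eq_square power4_eq_xxxx)

lemma long_eigen_add: "long_eigen Y + long_eigen (- Y) = embed X_inf Y long_fun"
  by (simp add: embed_long_fun long_eigen_def field_simps)

text \<open>Both sides satisfy the recurrence with factor m + 1/m in p and the one with factor l +
  1/l in q. They are compared first in p, for q = 0 and q = 1, and then in q.\<close>

lemma embed_periph_fun:
  "embed X_inf Y (periph_fun p q) =
    fls_X_inv powi p * long_eigen Y powi q + inverse (fls_X_inv powi p * long_eigen Y powi q)"
proof -
  define u t where "u = (fls_X_inv :: complex fls)" and "t = (fls_X :: complex fls)"
  define l k where "l = long_eigen Y" and "k = long_eigen (- Y)"
  have ut: "u * t = 1" by (simp add: u_def t_def fls_X_inv_mult_X)
  have X: "X_inf = u + t" by (simp add: X_inf_def u_def t_def)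
  have lk: "l * k = 1" by (simp add: l_def k_def long_eigen_mult)
  have nz: "u \<noteq> 0" "l \<noteq> 0" using ut lk by auto
  have inv: "inverse u = t" "inverse l = k"
    using ut lk by (metis inverse_unique mult.commute)+
  define E where "E p q = u powi p * l powi q + inverse (u powi p * l powi q)" for p q
  have shift: "u powi (n + 1) = u powi n * u" "u powi (n - 1) = u powi n * t"
    "l powi (n + 1) = l powi n * l" "l powi (n - 1) = l powi n * k" for n
    using nz inv power_int_add[of u n 1] power_int_diff[of u n 1]
      power_int_add[of l n 1] power_int_diff[of l n 1]
    by (auto simp: divide_inverse)
  have inv': "inverse t = u" "inverse k = l"
    using inv by auto
  have E1: "E (p + 1) q + E (p - 1) q = (u + t) * E p q" for p q
    unfolding E_def shift by (simp add: inv inv' algebra_simps)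
  have E2: "E p (q + 1) + E p (q - 1) = (l + k) * E p q" for p q
    unfolding E_def shift by (simp add: inv inv' algebra_simps)
  define T where "T p q = embed X_inf Y (periph_fun p q)" for p q
  have x: "embed X_inf Y x_fun = u + t" by (simp add: X)
  have T1: "T (p + 1) q + T (p - 1) q = (u + t) * T p q" for p q
    using arg_cong[OF periph_fun_rec(1)[of p q], of "embed X_inf Y"] x
    by (simp add: T_def del: embed_CF)
  have T2: "T p (q + 1) + T p (q - 1) = (l + k) * T p q" for p q
    using arg_cong[OF periph_fun_rec(2)[of p q], of "embed X_inf Y"] long_eigen_add
    by (simp add: T_def l_def k_def)
  have e1: "embed X_inf Y 1 = 1" by (simp add: one_curve_fun_def)
  have "embed X_inf Y 2 = 2" using embed_add[of 1 1] e1 by simp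
  then have 00: "T 0 0 = E 0 0" by (simp add: T_def E_def periph_fun_base)
  have 10: "T 1 0 = E 1 0" using x inv by (simp add: T_def E_def periph_fun_base del: embed_CF)
  have 01: "T 0 1 = E 0 1" using long_eigen_add inv by (simp add: T_def E_def periph_fun_base l_def k_def)
  have l2: "2 * l = X_inf ^ 4 - 5 * X_inf ^ 2 + 2 - (u ^ 2 - t ^ 2) * Y"
    and k2: "2 * k = X_inf ^ 4 - 5 * X_inf ^ 2 + 2 + (u ^ 2 - t ^ 2) * Y"
    by (simp_all add: l_def k_def long_eigen_def u_def t_def)
  \<comment> \<open>The other three initial values are unchanged when l and its inverse k are
    exchanged; this one pairs l with m = u.\<close>
  have "embed X_inf Y (2 * periph_fun 1 1) = 2 * T 1 1"
    unfolding mult_2 embed_add T_def ..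
  then have "2 * T 1 1 = 2 * X_inf - 5 * X_inf ^ 3 + X_inf ^ 5 + (4 * X_inf - X_inf ^ 3) * Y"
    unfolding periph_fun_base by (simp add: algebra_simps eval_nat_numeral)
  also have "\<dots> = u * (2 * l) + t * (2 * k)"
    unfolding l2 k2 X using ut by algebra
  also have "\<dots> = 2 * (u * l + t * k)" by (simp add: algebra_simps)
  finally have "T 1 1 = u * l + t * k" by (metis mult_left_cancel zero_neq_numeral)
  then have 11: "T 1 1 = E 1 1" using inv by (simp add: E_def)
  have p0: "T p 0 = E p 0" for p
    by (rule recurrence_unique[where F = "\<lambda>p. T p 0" and G = "\<lambda>p. E p 0", OF T1 E1 00 10])
  have p1: "T p 1 = E p 1" for p
    by (rule recurrence_unique[where F = "\<lambda>p. T p 1" and G = "\<lambda>p. E p 1", OF T1 E1 01 11])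
  have "T p q = E p q"
    by (rule recurrence_unique[where F = "T p" and G = "E p", OF T2 E2 p0 p1])
  then show ?thesis by (simp add: T_def E_def u_def l_def)
qed

text \<open>The two series are inverse to each other, and their sum has order -4 because x has order
  -1. So the orders are 4 and -4; which series has which depends on the choice of Y.\<close>

lemma long_eigen_subdegree: "fls_subdegree (long_eigen Y) = 4 \<or> fls_subdegree (long_eigen Y) = -4"
    "fls_subdegree (long_eigen (- Y)) = - fls_subdegree (long_eigen Y)"
proof -
  interpret curve_valuation "\<lambda>h. fls_subdegree (embed X_inf Y h)" by (rule infinite_valuation(1)[OF Y])
  let ?l = "long_eigen Y" and ?k = "long_eigen (- Y)"
  have nz: "?l \<noteq> 0" "?k \<noteq> 0" using long_eigen_mult by auto
  have "fls_subdegree (?l * ?k) = 0" using long_eigen_mult by simp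
  then show neg: "fls_subdegree ?k = - fls_subdegree ?l" using nz by simp
  have s: "fls_subdegree (?l + ?k) = -4"
    unfolding long_eigen_add long_fun_def
    using v_poly_infinite[of "[:2, 0, -5, 0, 1:]"] infinite_valuation(2)[OF Y]
    by (simp del: embed_CF)
  consider "fls_subdegree ?l < fls_subdegree ?k" | "fls_subdegree ?k < fls_subdegree ?l"
    | "fls_subdegree ?l = 0" "fls_subdegree ?k = 0"
    using neg by linarith
  then show "fls_subdegree ?l = 4 \<or> fls_subdegree ?l = -4"
  proof cases
    case 1
    then show ?thesis using fls_subdegree_add_eq1[OF nz(1) 1] s by simp
  next
    case 2
    then show ?thesis using fls_subdegree_add_eq2[OF nz(2) 2] s neg by simp
  next
    case 3
    have "?l + ?k \<noteq> 0" using s by auto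
    then show ?thesis using fls_plus_subdegree[of ?l ?k] s 3 by simp
  qed
qed

text \<open>The trace is g + 1/g for g = m^p l^q, so its square minus 4 is (g - 1/g)^2, with a pole
  of twice the absolute order of g. The term - p comes from m = 1/t.\<close>

lemma infinite_pole_order:
  "max 0 (- fls_subdegree (embed X_inf Y (periph_fun p q * periph_fun p q - const_fun 4))) =
    2 * \<bar>q * fls_subdegree (long_eigen Y) - p\<bar>"
proof -
  define g where "g = fls_X_inv powi p * long_eigen Y powi q"
  have l: "long_eigen Y \<noteq> 0" using long_eigen_mult by auto
  then have g0: "g \<noteq> 0" by (simp add: g_def)
  have ord: "fls_subdegree g = q * fls_subdegree (long_eigen Y) - p"
    using l by (simp add: g_def)
  have ord': "fls_subdegree (inverse g) = - fls_subdegree g" by simp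
  have "embed X_inf Y (periph_fun p q * periph_fun p q - const_fun 4) = (g + inverse g) * (g + inverse g) - 4"
    by (simp add: embed_periph_fun g_def)
  also have "\<dots> = (g - inverse g) * (g - inverse g)"
    using g0 by (simp add: field_simps)
  finally have e: "fls_subdegree (embed X_inf Y (periph_fun p q * periph_fun p q - const_fun 4)) =
      2 * fls_subdegree (g - inverse g)"
    by (cases "g - inverse g = 0") simp_all
  consider "fls_subdegree g < 0" | "0 < fls_subdegree g" | "fls_subdegree g = 0" by linarith
  then have "max 0 (- fls_subdegree (g - inverse g)) = \<bar>fls_subdegree g\<bar>"
  proof cases
    case 1
    then show ?thesis using fls_subdegree_diff_eq1[of g "inverse g"] g0 by simp
  next
    case 2
    then show ?thesis using fls_subdegree_diff_eq2[of "inverse g" g] g0 by simp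
  next
    \<comment> \<open>Here g may equal its inverse; the zero series has subdegree 0 by
      convention.\<close>
    case 3
    then show ?thesis
      using fls_plus_subdegree[of g "- inverse g"] by (cases "g - inverse g = 0") simp_all
  qed
  then show ?thesis unfolding e ord[symmetric] by linarith
qed

end

lemma embed_conj: "embed X Y (conj_fun h) = embed X (- Y) h"
  by (cases h) simp

text \<open>The second place at infinity is the first one composed with conjugation, that is with Y
  replaced by -Y, which inverts l and keeps m. The sum is symmetric in the sign of the order of l,
  so both cases of \<open>long_eigen_subdegree\<close> lead to it.\<close>

lemma map_degree_f_gamma:
  "map_degree fig8_curve (f_gamma fig8_curve (peripheral p q)) = 2 * (\<bar>p + 4 * q\<bar> + \<bar>p - 4 * q\<bar>)"
proof -
  obtain Y where Y: "series_point X_inf Y" by (rule infinite_point_exists)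
  define f where "f = periph_fun p q * periph_fun p q - const_fun 4"
  define v where "v h = fls_subdegree (embed X_inf Y h)" for h
  have "v \<in> infinite_places"
    using infinite_valuation[OF Y] by (simp add: infinite_places_def places_def v_def[abs_def] del: embed_CF)
  note e = infinite_places_eq[OF this]
  have "map_degree fig8_curve (f_gamma fig8_curve (peripheral p q)) = (\<Sum>w\<in>infinite_places. max 0 (- w f))"
    unfolding f_gamma_regular map_degree_regular f_def ..
  also have "\<dots> = max 0 (- v f) + max 0 (- v (conj_fun f))"
    by (subst e(1)) (use e(2) in simp)
  also have "\<dots> = 2 * \<bar>q * fls_subdegree (long_eigen Y) - p\<bar> + 2 * \<bar>q * - fls_subdegree (long_eigen Y) - p\<bar>"
    using infinite_pole_order[OF Y, of p q] infinite_pole_order[OF series_point_uminus[OF Y], of p q]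
      long_eigen_subdegree(2)[OF Y]
    by (simp add: v_def f_def embed_conj del: conj_fun_simps embed_CF)
  also have "\<dots> = 2 * (\<bar>p + 4 * q\<bar> + \<bar>p - 4 * q\<bar>)"
  proof -
    have "\<bar>q * 4 - p\<bar> = \<bar>p - 4 * q\<bar>" "\<bar>q * - 4 - p\<bar> = \<bar>p + 4 * q\<bar>"
      by (simp_all add: abs_if)
    then show ?thesis
      using long_eigen_subdegree(1)[OF Y] by (elim disjE) (simp_all only: minus_minus, simp_all)
  qed
  finally show ?thesis .
qed

section \<open>The norm\<close>

lemma is_norm_nonneg:
  assumes "is_norm N"
  shows "0 \<le> N u"
proof -
  have tri: "\<And>u v. N (u + v) \<le> N u + N v" and hom: "\<And>c u. N (c *\<^sub>R u) = \<bar>c\<bar> * N u"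
    using assms by (auto simp: is_norm_def)
  have "N (u + (-1) *\<^sub>R u) \<le> N u + N ((-1) *\<^sub>R u)" by (rule tri)
  then show ?thesis using hom[of "-1" u] hom[of 0 u] by simp
qed

text \<open>Rounding moves a point by fractional parts in [0, 1) along the two axes, so the bound
  does not depend on the point.\<close>

lemma is_norm_floor_dist:
  fixes N :: "real \<times> real \<Rightarrow> real"
  assumes N: "is_norm N"
  shows "\<bar>N (a, b) - N (of_int \<lfloor>a\<rfloor>, of_int \<lfloor>b\<rfloor>)\<bar> \<le> N (1, 0) + N (0, 1)"
proof -
  have tri: "\<And>u v. N (u + v) \<le> N u + N v" and hom: "\<And>c u. N (c *\<^sub>R u) = \<bar>c\<bar> * N u"
    using N by (auto simp: is_norm_def)
  define u v where "u = (a, b)" and "v = (of_int \<lfloor>a\<rfloor> :: real, of_int \<lfloor>b\<rfloor> :: real)"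
  have "u - v = (a - of_int \<lfloor>a\<rfloor>) *\<^sub>R (1, 0) + (b - of_int \<lfloor>b\<rfloor>) *\<^sub>R (0, 1)"
    by (simp add: u_def v_def)
  then have "N (u - v) \<le> \<bar>a - of_int \<lfloor>a\<rfloor>\<bar> * N (1, 0) + \<bar>b - of_int \<lfloor>b\<rfloor>\<bar> * N (0, 1)"
    using tri[of "(a - of_int \<lfloor>a\<rfloor>) *\<^sub>R (1, 0)" "(b - of_int \<lfloor>b\<rfloor>) *\<^sub>R (0, 1)"] by (simp only: hom)
  also have "\<dots> \<le> 1 * N (1, 0) + 1 * N (0, 1)"
    by (intro add_mono mult_right_mono is_norm_nonneg[OF N]) linarith+
  finally have "N (u - v) \<le> N (1, 0) + N (0, 1)" by simp
  moreover have "N (v - u) = N (u - v)" using hom[of "-1" "u - v"] by simp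
  moreover have "N u \<le> N v + N (u - v)" "N v \<le> N u + N (v - u)"
    using tri[of v "u - v"] tri[of u "v - u"] by simp_all
  ultimately show ?thesis unfolding u_def[symmetric] v_def[symmetric] by linarith
qed

text \<open>At the n-fold of u the norms differ by n times their difference at u, while rounding to
  an integer point, where they agree, bounds this by a constant. Large n forces the difference to be
  0.\<close>

lemma is_norm_unique:
  fixes M N :: "real \<times> real \<Rightarrow> real"
  assumes M: "is_norm M" and N: "is_norm N"
    and eq: "\<And>p q :: int. M (of_int p, of_int q) = N (of_int p, of_int q)"
  shows "M = N"
proof
  fix u :: "real \<times> real"
  obtain a b where u: "u = (a, b)" by (cases u)
  define K where "K = M (1, 0) + M (0, 1) + (N (1, 0) + N (0, 1))"
  have K: "real n * \<bar>M u - N u\<bar> \<le> K" for n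
  proof -
    have "M (real n * a, real n * b) = real n * M u" "N (real n * a, real n * b) = real n * N u"
      using M N unfolding is_norm_def by (metis abs_of_nat scaleR_Pair real_scaleR_def u)+
    then have "\<bar>real n * M u - real n * N u\<bar> \<le> K"
      using is_norm_floor_dist[OF M, of "real n * a" "real n * b"]
        is_norm_floor_dist[OF N, of "real n * a" "real n * b"]
        eq[of "\<lfloor>real n * a\<rfloor>" "\<lfloor>real n * b\<rfloor>"]
      unfolding K_def by linarith
    then show ?thesis by (simp add: abs_mult flip: right_diff_distrib)
  qed
  show "M u = N u"
  proof (rule ccontr)
    assume "M u \<noteq> N u"
    then obtain n where "K < real n * \<bar>M u - N u\<bar>"
      using reals_Archimedean3[of "\<bar>M u - N u\<bar>"] by auto
    then show False using K[of n] by simp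
  qed
qed

lemma is_norm_formula:
  "is_norm (\<lambda>(a :: real, b :: real). 2 * (\<bar>a + 4 * b\<bar> + \<bar>a - 4 * b\<bar>))"
proof -
  have hom: "\<bar>c * a + 4 * (c * b)\<bar> = \<bar>c\<bar> * \<bar>a + 4 * b\<bar>" "\<bar>c * a - 4 * (c * b)\<bar> = \<bar>c\<bar> * \<bar>a - 4 * b\<bar>"
    for a b c :: real
    by (simp_all add: algebra_simps flip: abs_mult)
  have zero: "2 * (\<bar>a + 4 * b\<bar> + \<bar>a - 4 * b\<bar>) = 0 \<longleftrightarrow> a = 0 \<and> b = 0" for a b :: real
    by (auto simp: abs_if split: if_splits)
  have tri: "2 * (\<bar>(a + c) + 4 * (b + d)\<bar> + \<bar>(a + c) - 4 * (b + d)\<bar>) \<le>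
      2 * (\<bar>a + 4 * b\<bar> + \<bar>a - 4 * b\<bar>) + 2 * (\<bar>c + 4 * d\<bar> + \<bar>c - 4 * d\<bar>)" for a b c d :: real
    using abs_triangle_ineq[of "a + 4 * b" "c + 4 * d"] abs_triangle_ineq[of "a - 4 * b" "c - 4 * d"]
    by (simp add: algebra_simps)
  show ?thesis
    unfolding is_norm_def split_paired_all scaleR_Pair add_Pair prod.case zero_prod_def prod.inject
      real_scaleR_def hom split_paired_All
    using zero tri by (simp add: algebra_simps)
qed

theorem proposition5p9:
  fixes X\<^sub>0 :: "character set" and p q :: int
  assumes "canonical_component X\<^sub>0"
  shows "culler_shalen_norm X\<^sub>0 (of_int p, of_int q) =
           2 * (\<bar>of_int p + 4 * of_int q\<bar> + \<bar>of_int p - 4 * of_int q\<bar>)"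
proof -
  let ?N = "\<lambda>(a :: real, b :: real). 2 * (\<bar>a + 4 * b\<bar> + \<bar>a - 4 * b\<bar>)"
  have "culler_shalen_norm X\<^sub>0 = ?N"
    unfolding culler_shalen_norm_def canonical_component_eq[OF assms] map_degree_f_gamma
  proof (rule the_equality)
    show "is_norm ?N \<and> (\<forall>p q :: int. ?N (of_int p, of_int q) =
        of_int (2 * (\<bar>p + 4 * q\<bar> + \<bar>p - 4 * q\<bar>)))"
      using is_norm_formula by simp
    then show "N = ?N" if "is_norm N \<and> (\<forall>p q :: int. N (of_int p, of_int q) =
        of_int (2 * (\<bar>p + 4 * q\<bar> + \<bar>p - 4 * q\<bar>)))" for N
      using that by (intro is_norm_unique) auto
  qed
  then show ?thesis by simp
qed

end
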